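(* Let $1\le m\le n$, let $U\subset\mathbb{R}^m$ be a domain with coordinates $(t_1,\dots,t_m)$, let $\Phi:U\to \mathrm{Spin}(\mathbb{R}^{n+2}_1)$ be smooth, and put $f:=\Phi^{-1}e_0\Phi$, $\hat f:=\Phi^{-1}e_\infty\Phi: U\to L^{n+1}$, where at least one of $f,\hat f$ induces an immersion into the conformal $n$-sphere. Then $\Phi$ is an adapted frame for a Ribaucour pair $f,\hat f$ of orthogonal systems in the conformal $n$-sphere if and only if there are functions $l_j,\hat l_j,\gamma_{ij},a_{ij}:U\to\mathbb{R}$ with $\gamma_{jj}=0$ such that for all $1\le j\le m$ $$\Phi_j=\Big(l_j e_\infty+\tfrac12\sum_{i=1}^m\gamma_{ij}e_i+\tfrac12\sum_{i=m+1}^{n}a_{ij}e_i+\hat l_j e_0\Big)e_j\cdot\Phi,\qquad \Phi_j:=\frac{\partial\Phi}{\partial t_j}.$$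
   Context: $\mathbb{R}^{n+2}_1$ is Minkowski space with Lorentz product $\langle\cdot,\cdot\rangle$ and basis $(e_0,e_1,\dots,e_n,e_\infty)$ with $\langle e_i,e_j\rangle=\delta_{ij}$ for $1\le i,j\le n$, $\langle e_0,e_0\rangle=\langle e_\infty,e_\infty\rangle=0$, $\langle e_0,e_\infty\rangle=-\frac12$, $\langle e_0,e_i\rangle=\langle e_\infty,e_i\rangle=0$. Products are taken in its Clifford algebra with the convention $vw+wv=-2\langle v,w\rangle$ (so $e_i^2=-1$, $e_0e_\infty+e_\infty e_0=1$). $L^{n+1}=\{v:\langle v,v\rangle=0\}$ (nonzero vectors) is the light cone, $S^{n+1}_1=\{v:\langle v,v\rangle=1\}$, and $\mathrm{Spin}(\mathbb{R}^{n+2}_1)=\{\prod_{j=1}^{2r}s_j : s_j\in S^{n+1}_1\}$, acting on vectors by $p\mapsto\Phi^{-1}p\Phi$. Points of the conformal $n$-sphere $S^n$ are the null lines of $\mathbb{R}^{n+2}_1$; maps into $S^n$ are represented by lifts to $L^{n+1}$. A $k$-sphere in $S^n$ corresponds to a $(k+2)$-dimensional timelike subspace of $\mathbb{R}^{n+2}_1$ (it consists of the null lines in that subspace). Definitions. A map $g:M^k\to S^n$ envelopes a congruence of $k$-spheres (a $k$-parameter family $s(p)$, $p\in M^k$) if at every $p\in M^k$ it has first order contact with $s(p)$. A congruence of $k$-spheres is Ribaucour if it has two envelopes with well defined curvature lines (i.e. independent of the normal direction; flat normal bundle) that correspond. Two nets $f,\hat f:U\subset\mathbb{R}^m\to S^n$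 form a Ribaucour pair of orthogonal systems if any corresponding $k$-dimensional coordinate subnets, $1\le k\le m$, envelope a Ribaucour congruence of $k$-spheres; the curvature lines are the coordinate lines, and in particular coordinate lines intersect orthogonally. One of the nets $f,\hat f$ is allowed to degenerate (e.g. to be constant). Adapted frame. $\Phi$ is an adapted frame for the pair if $f=\Phi^{-1}e_0\Phi$, $\hat f=\Phi^{-1}e_\infty\Phi$, where the lifts are normalized to be parallel, $\langle df,\hat f\rangle=0$; the vectors $s_i:=\Phi^{-1}e_i\Phi$, $1\le i\le m$, are the principal directions of $f$ and $\hat f$ (i.e. $\partial f/\partial t_i$ and $\partial\hat f/\partial t_i$ are multiples of $s_i$); and the $s_i$, $m+1\le i\le n$, form an orthonormal basis of $\{f,\hat f,s_1,\dots,s_m\}^\perp$ that is parallel for the connection induced by orthogonal projection (for $f$ immersed this bundle is $\{f,\hat f,df(TU)\}^\perp$). *)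

theory Defs
  imports "HOL-Analysis.Analysis"
begin

section \<open>Minkowski space\<close>

text \<open>
  A vector is given by its coordinates \<open>(v\<^sub>0, (v\<^sub>i)\<^sub>i, v\<^sub>\<infinity>)\<close> in the basis
  \<open>(e\<^sub>0, (e\<^sub>i)\<^sub>i, e\<^sub>\<infinity>)\<close>; the dimension is \<open>n + 2\<close> with \<open>n = CARD('n)\<close>.
\<close>

type_synonym 'n mink = "real \<times> (real ^ 'n) \<times> real"

definition e_zero :: "'n::finite mink" where "e_zero = (1, 0, 0)"
definition e_infty :: "'n::finite mink" where "e_infty = (0, 0, 1)"
definition e_space :: "'n::finite \<Rightarrow> 'n mink" where "e_space i = (0, axis i 1, 0)"

definition lorentz :: "'n::finite mink \<Rightarrow> 'n mink \<Rightarrow> real" where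
  "lorentz v w =
     fst (snd v) \<bullet> fst (snd w) - (fst v * snd (snd w) + snd (snd v) * fst w) / 2"

lemma lorentz_basis:
  "lorentz (e_space i) (e_space j) = (if i = j then 1 else 0)"
  "lorentz e_zero e_zero = 0" "lorentz e_infty e_infty = 0"
  "lorentz e_zero e_infty = - 1 / 2"
  "lorentz e_zero (e_space i) = 0" "lorentz e_infty (e_space i) = 0"
  by (auto simp: lorentz_def e_space_def e_zero_def e_infty_def inner_axis_axis)

definition lorentz_perp :: "'n::finite mink set \<Rightarrow> 'n mink set" where
  "lorentz_perp S = {v. \<forall>w\<in>S. lorentz v w = 0}"

definition light_cone :: "'n::finite mink set" where
  "light_cone = {v. v \<noteq> 0 \<and> lorentz v v = 0}"

definition unit_spacelike :: "'n::finite mink set" where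
  "unit_spacelike = {v. lorentz v v = 1}"


section \<open>The Clifford algebra of Minkowski space\<close>

text \<open>
  An element of the Clifford algebra is given by its coefficients with respect to the basis of
  ordered products of orthonormal generators: \<open>Inl i\<close> stands for \<open>e\<^sub>i\<close>, and
  \<open>Inr False\<close>, \<open>Inr True\<close> for the unit spacelike and timelike vectors
  \<open>e\<^sub>0 - e\<^sub>\<infinity>\<close> and \<open>e\<^sub>0 + e\<^sub>\<infinity>\<close>.
  The generators are ordered by an arbitrary enumeration (\<open>to_nat\<close>).
\<close>

typedef 'n clifford = "UNIV :: (('n::finite + bool) set \<Rightarrow> real) set"
  morphisms coef Clifford by simp

setup_lifting type_definition_clifford

lemma clifford_eq_iff: "x = y \<longleftrightarrow> (\<forall>A. coef x A = coef y A)"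
  by transfer auto

definition gen_square :: "'n::finite + bool \<Rightarrow> real" where
  "gen_square a = (if a = Inr True then 1 else - 1)"

text \<open>
  The sign in \<open>e\<^sub>A e\<^sub>B = blade_sign A B e\<^sub>C\<close>, where \<open>C\<close> is the symmetric
  difference of \<open>A\<close> and \<open>B\<close>: each pair that has to be interchanged contributes
  \<open>-1\<close>, each common generator its square.
\<close>

definition gen_sign :: "'n::finite + bool \<Rightarrow> 'n + bool \<Rightarrow> real" where
  "gen_sign a b = (if a = b then gen_square a else if to_nat b < to_nat a then - 1 else 1)"

definition blade_sign :: "('n::finite + bool) set \<Rightarrow> ('n + bool) set \<Rightarrow> real" where
  "blade_sign A B = (\<Prod>a\<in>A. \<Prod>b\<in>B. gen_sign a b)"

instantiation clifford :: (finite) real_vector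
begin
lift_definition zero_clifford :: "'a clifford" is "\<lambda>A. 0" .
lift_definition plus_clifford :: "'a clifford \<Rightarrow> 'a clifford \<Rightarrow> 'a clifford"
  is "\<lambda>x y A. x A + y A" .
lift_definition minus_clifford :: "'a clifford \<Rightarrow> 'a clifford \<Rightarrow> 'a clifford"
  is "\<lambda>x y A. x A - y A" .
lift_definition uminus_clifford :: "'a clifford \<Rightarrow> 'a clifford" is "\<lambda>x A. - x A" .
lift_definition scaleR_clifford :: "real \<Rightarrow> 'a clifford \<Rightarrow> 'a clifford" is "\<lambda>r x A. r * x A" .
instance by standard (transfer; auto simp: fun_eq_iff algebra_simps)+
end

instantiation clifford :: (finite) real_inner
begin
definition inner_clifford :: "'a clifford \<Rightarrow> 'a clifford \<Rightarrow> real" where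
  "inner_clifford x y = (\<Sum>A\<in>UNIV. coef x A * coef y A)"
definition norm_clifford :: "'a clifford \<Rightarrow> real" where
  "norm_clifford x = sqrt (inner x x)"
definition sgn_clifford :: "'a clifford \<Rightarrow> 'a clifford" where
  "sgn_clifford x = x /\<^sub>R norm x"
definition dist_clifford :: "'a clifford \<Rightarrow> 'a clifford \<Rightarrow> real" where
  "dist_clifford x y = norm (x - y)"
definition uniformity_clifford :: "('a clifford \<times> 'a clifford) filter" where
  "uniformity_clifford = (INF e\<in>{0 <..}. principal {(x, y). dist x y < e})"
definition open_clifford :: "'a clifford set \<Rightarrow> bool" where
  "open_clifford S = (\<forall>x\<in>S. \<forall>\<^sub>F (x', y) in uniformity. x' = x \<longrightarrow> y \<in> S)"
instance
proof
  fix x y z :: "'a clifford" and r :: real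
  show "inner x y = inner y x"
    by (simp add: inner_clifford_def mult.commute)
  show "inner (x + y) z = inner x z + inner y z"
    by (simp add: inner_clifford_def plus_clifford.rep_eq distrib_right sum.distrib)
  show "inner (r *\<^sub>R x) y = r * inner x y"
    by (simp add: inner_clifford_def scaleR_clifford.rep_eq sum_distrib_left mult.assoc)
  show "0 \<le> inner x x"
    by (simp add: inner_clifford_def sum_nonneg)
  show "inner x x = 0 \<longleftrightarrow> x = 0"
    by (simp add: inner_clifford_def sum_nonneg_eq_0_iff clifford_eq_iff zero_clifford.rep_eq)
qed (simp_all add: norm_clifford_def sgn_clifford_def dist_clifford_def uniformity_clifford_def
      open_clifford_def)
end

lift_definition blade :: "('n::finite + bool) set \<Rightarrow> 'n clifford"
  is "\<lambda>A B. if B = A then 1 else 0" .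

lemma inner_blade: "x \<bullet> blade A = coef x A"
  by (simp add: inner_clifford_def blade.rep_eq if_distrib cong: if_cong)

instantiation clifford :: (finite) euclidean_space
begin
definition Basis_clifford :: "'a clifford set" where "Basis_clifford = range blade"
instance
  by standard
    (auto simp: Basis_clifford_def inner_blade blade.rep_eq clifford_eq_iff zero_clifford.rep_eq)
end

lemma gen_sign_sq: "gen_sign a b * gen_sign a b = 1"
  by (simp add: gen_sign_def gen_square_def)

lemma prod_sym_diff:
  fixes h :: "'a::finite \<Rightarrow> real"
  assumes "\<And>a. h a * h a = 1"
  shows "prod h (sym_diff A B) = prod h A * prod h B"
proof -
  have sq: "prod h C * prod h C = 1" for C
    using assms by (simp flip: prod.distrib)
  have "prod h A = prod h (A \<inter> B) * prod h (A - B)"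
    by (rule prod.Int_Diff) simp
  moreover have "prod h B = prod h (B \<inter> A) * prod h (B - A)"
    by (rule prod.Int_Diff) simp
  moreover have "prod h (sym_diff A B) = prod h (A - B) * prod h (B - A)"
    by (rule prod.union_disjoint) auto
  ultimately show ?thesis
    using sq[of "A \<inter> B"] by (simp add: Int_commute mult.assoc mult.left_commute)
qed

lemma blade_sign_left: "blade_sign (sym_diff A B) C = blade_sign A C * blade_sign B C"
  unfolding blade_sign_def
  by (rule prod_sym_diff) (simp flip: prod.distrib add: gen_sign_sq)

lemma blade_sign_right: "blade_sign A (sym_diff B C) = blade_sign A B * blade_sign A C"
proof -
  have "(\<Prod>b\<in>sym_diff B C. gen_sign a b)
      = (\<Prod>b\<in>B. gen_sign a b) * (\<Prod>b\<in>C. gen_sign a b)" for a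
    by (rule prod_sym_diff) (rule gen_sign_sq)
  then show ?thesis
    by (simp add: blade_sign_def prod.distrib)
qed

lemma blade_sign_empty [simp]: "blade_sign {} A = 1" "blade_sign A {} = 1"
  by (simp_all add: blade_sign_def)

instantiation clifford :: (finite) real_algebra_1
begin
lift_definition times_clifford :: "'a clifford \<Rightarrow> 'a clifford \<Rightarrow> 'a clifford"
  is "\<lambda>x y C. \<Sum>A\<in>UNIV. blade_sign A (sym_diff A C) * x A * y (sym_diff A C)" .
definition one_clifford :: "'a clifford" where "one_clifford = blade {}"
instance
proof
  fix x y z :: "'a clifford" and r :: real
  let ?d = "sym_diff :: ('a + bool) set \<Rightarrow> _ \<Rightarrow> _"
  have regroup: "a * p * (b * q * t) = d * c * p * q * t" if "a * b = c * d"
    for a b c d p q t :: real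
  proof -
    have "a * p * (b * q * t) = (a * b) * (p * q * t)" by (simp only: mult_ac)
    then show ?thesis by (simp only: that mult_ac)
  qed
  show "x * y * z = x * (y * z)"
  proof (unfold clifford_eq_iff, rule allI)
    fix D :: "('a + bool) set"
    have "coef (x * y * z) D = (\<Sum>E\<in>UNIV. \<Sum>A\<in>UNIV. blade_sign E (?d E D) *
        blade_sign A (?d A E) * coef x A * coef y (?d A E) * coef z (?d E D))"
      by (simp add: times_clifford.rep_eq sum_distrib_left sum_distrib_right mult.assoc)
    also have "\<dots> = (\<Sum>A\<in>UNIV. \<Sum>E\<in>UNIV. blade_sign E (?d E D) *
        blade_sign A (?d A E) * coef x A * coef y (?d A E) * coef z (?d E D))"
      by (rule sum.swap)
    also have "\<dots> = (\<Sum>A\<in>UNIV. \<Sum>F\<in>UNIV. blade_sign A (?d A D) * coef x A *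
        (blade_sign F (?d F (?d A D)) * coef y F * coef z (?d F (?d A D))))"
    proof (rule sum.cong[OF refl])
      fix A :: "('a + bool) set"
      show "(\<Sum>E\<in>UNIV. blade_sign E (?d E D) *
          blade_sign A (?d A E) * coef x A * coef y (?d A E) * coef z (?d E D))
        = (\<Sum>F\<in>UNIV. blade_sign A (?d A D) * coef x A *
          (blade_sign F (?d F (?d A D)) * coef y F * coef z (?d F (?d A D))))"
      proof (rule sum.reindex_bij_witness[where i = "?d A" and j = "?d A"])
        fix E :: "('a + bool) set"
        have 1: "?d (?d A E) (?d A D) = ?d E D" by auto
        have 2: "?d A E = ?d (?d A D) (?d E D)" by auto
        have "blade_sign A (?d A D) * blade_sign (?d A E) (?d E D)
            = blade_sign A (?d A E) * blade_sign E (?d E D)"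
          by (subst (2) 2) (simp only: blade_sign_left blade_sign_right mult_ac)
        then show "blade_sign A (?d A D) * coef x A *
            (blade_sign (?d A E) (?d (?d A E) (?d A D)) * coef y (?d A E) *
             coef z (?d (?d A E) (?d A D))) =
            blade_sign E (?d E D) * blade_sign A (?d A E) * coef x A * coef y (?d A E) *
             coef z (?d E D)"
          unfolding 1 by (rule regroup)
      qed auto
    qed
    also have "\<dots> = coef (x * (y * z)) D"
      by (simp add: times_clifford.rep_eq sum_distrib_left)
    finally show "coef (x * y * z) D = coef (x * (y * z)) D" .
  qed
  show "(x + y) * z = x * z + y * z"
    by transfer (simp add: fun_eq_iff algebra_simps sum.distrib)
  show "x * (y + z) = x * y + x * z"
    by transfer (simp add: fun_eq_iff algebra_simps sum.distrib)
  show "r *\<^sub>R x * y = r *\<^sub>R (x * y)"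
    by transfer (simp add: fun_eq_iff sum_distrib_left mult_ac)
  show "x * r *\<^sub>R y = r *\<^sub>R (x * y)"
    by transfer (simp add: fun_eq_iff sum_distrib_left mult_ac)
  show "1 * x = x"
    by (simp add: one_clifford_def clifford_eq_iff times_clifford.rep_eq blade.rep_eq
        if_distrib[of "\<lambda>t. _ * t"] if_distrib[of "\<lambda>t. t * _"] cong: if_cong)
  show "x * 1 = x"
  proof -
    have "sym_diff A C = {} \<longleftrightarrow> A = C" for A C :: "('a + bool) set" by auto
    then show ?thesis
      by (simp add: one_clifford_def clifford_eq_iff times_clifford.rep_eq blade.rep_eq
          if_distrib[of "\<lambda>t. _ * t"] cong: if_cong)
  qed
  show "(0 :: 'a clifford) \<noteq> 1"
    by (auto simp: one_clifford_def clifford_eq_iff zero_clifford.rep_eq blade.rep_eq)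
qed
end

lemma blade_mult: "blade A * blade B = blade_sign A B *\<^sub>R blade (sym_diff A B)"
proof -
  have "coef (blade A * blade B) C = blade_sign A B * (if C = sym_diff A B then 1 else 0)" for C
  proof -
    have "coef (blade A * blade B) C = (\<Sum>X\<in>UNIV. if X = A then
        blade_sign A (sym_diff A C) * (if sym_diff A C = B then 1 else 0) else 0)"
      unfolding times_clifford.rep_eq blade.rep_eq by (rule sum.cong) auto
    also have "\<dots> = blade_sign A (sym_diff A C) * (if sym_diff A C = B then 1 else 0)"
      by simp
    also have "\<dots> = blade_sign A B * (if C = sym_diff A B then 1 else 0)"
    proof -
      have *: "sym_diff A C = B \<longleftrightarrow> C = sym_diff A B" by auto
      show ?thesis
      proof (cases "sym_diff A C = B")
        case True
        then show ?thesis using * by simp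
      next
        case False
        then have "C \<noteq> sym_diff A B" using * by simp
        then show ?thesis using False by simp
      qed
    qed
    finally show ?thesis .
  qed
  then show ?thesis
    by (simp add: clifford_eq_iff blade.rep_eq scaleR_clifford.rep_eq)
qed

text \<open>The embedding of Minkowski space into its Clifford algebra.\<close>

definition vec_clifford :: "'n::finite mink \<Rightarrow> 'n clifford" where
  "vec_clifford v =
     (\<Sum>i\<in>UNIV. (fst (snd v) $ i) *\<^sub>R blade {Inl i})
     + ((fst v - snd (snd v)) / 2) *\<^sub>R blade {Inr False}
     + ((fst v + snd (snd v)) / 2) *\<^sub>R blade {Inr True}"


lemma blade_anticomm:
  "blade {a} * blade {b} + blade {b} * blade {a}
   = (if a = b then (2 * gen_square a) *\<^sub>R 1 else 0)"
proof (cases "a = b")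
  case True
  then show ?thesis
    by (simp add: blade_mult blade_sign_def gen_sign_def one_clifford_def flip: scaleR_add_left)
next
  case False
  then have "sym_diff {a} {b} = sym_diff {b} {a}" by auto
  moreover have "gen_sign a b = - gen_sign b a"
    using False by (auto simp: gen_sign_def dest: inj_onD[OF inj_to_nat])
  ultimately show ?thesis
    using False by (simp add: blade_mult blade_sign_def)
qed

definition gen_coord :: "'n::finite mink \<Rightarrow> 'n + bool \<Rightarrow> real" where
  "gen_coord v a = (case a of Inl i \<Rightarrow> fst (snd v) $ i
     | Inr t \<Rightarrow> (if t then fst v + snd (snd v) else fst v - snd (snd v)) / 2)"

lemma sum_generators:
  fixes h :: "'n::finite + bool \<Rightarrow> 'b::ab_group_add"
  shows "sum h UNIV = (\<Sum>i\<in>UNIV. h (Inl i)) + h (Inr False) + h (Inr True)"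
proof -
  have "sum h (UNIV <+> UNIV) = (\<Sum>i\<in>UNIV. h (Inl i)) + (\<Sum>t\<in>UNIV. h (Inr t))"
    by (subst sum.Plus) (auto simp: comp_def)
  then show ?thesis unfolding UNIV_Plus_UNIV by (simp add: UNIV_bool algebra_simps)
qed

lemma vec_clifford_eq: "vec_clifford v = (\<Sum>a\<in>UNIV. gen_coord v a *\<^sub>R blade {a})"
  by (simp add: sum_generators vec_clifford_def gen_coord_def)

lemma lorentz_eq: "lorentz v w = - (\<Sum>a\<in>UNIV. gen_square a * (gen_coord v a * gen_coord w a))"
  by (simp add: sum_generators lorentz_def gen_coord_def gen_square_def inner_vec_def
      sum_negf field_simps)

theorem clifford_relation:
  "vec_clifford v * vec_clifford w + vec_clifford w * vec_clifford v = (- 2 * lorentz v w) *\<^sub>R 1"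
proof -
  let ?c = gen_coord
  have "vec_clifford v * vec_clifford w
      = (\<Sum>a\<in>UNIV. \<Sum>b\<in>UNIV. (?c v a * ?c w b) *\<^sub>R (blade {a} * blade {b}))"
    by (auto simp: vec_clifford_eq sum_product mult.commute intro!: sum.cong)
  moreover have "vec_clifford w * vec_clifford v
      = (\<Sum>b\<in>UNIV. \<Sum>a\<in>UNIV. (?c v a * ?c w b) *\<^sub>R (blade {b} * blade {a}))"
    by (auto simp: vec_clifford_eq sum_product mult.commute intro!: sum.cong)
  moreover have "\<dots>
      = (\<Sum>a\<in>UNIV. \<Sum>b\<in>UNIV. (?c v a * ?c w b) *\<^sub>R (blade {b} * blade {a}))"
    by (rule sum.swap)
  ultimately have "vec_clifford v * vec_clifford w + vec_clifford w * vec_clifford v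
      = (\<Sum>a\<in>UNIV. \<Sum>b\<in>UNIV. (?c v a * ?c w b) *\<^sub>R
           (blade {a} * blade {b} + blade {b} * blade {a}))"
    by (simp add: sum.distrib scaleR_add_right)
  also have "\<dots> = (\<Sum>a\<in>UNIV. (2 * (gen_square a * (?c v a * ?c w a))) *\<^sub>R 1)"
    unfolding blade_anticomm
    by (intro sum.cong refl) (simp add: if_distrib[of "\<lambda>t. _ *\<^sub>R t"] mult_ac cong: if_cong)
  also have "\<dots> = (- 2 * lorentz v w) *\<^sub>R 1"
    by (simp add: lorentz_eq sum_distrib_left sum_negf flip: scaleR_left.sum)
  finally show ?thesis .
qed

lemma gen_in_range: "\<exists>v. vec_clifford v = blade {a}"
proof -
  have *: "\<exists>v. \<forall>b. gen_coord v b = (if b = a then 1 else 0)"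
  proof (cases a)
    case (Inl i)
    then show ?thesis
      by (intro exI[of _ "(0, axis i 1, 0)"])
        (auto simp: gen_coord_def axis_def split: sum.splits)
  next
    case (Inr t)
    then show ?thesis
      by (intro exI[of _ "(1, 0, if t then 1 else - 1)"])
        (auto simp: gen_coord_def split: sum.splits)
  qed
  then obtain v where "\<forall>b. gen_coord v b = (if b = a then 1 else 0)" by blast
  then have "vec_clifford v = blade {a}"
    by (simp add: vec_clifford_eq if_distrib[of "\<lambda>t. t *\<^sub>R _"] cong: if_cong)
  then show ?thesis ..
qed

text \<open>
  The algebra is generated by the vectors and has dimension \<open>2\<^sup>n\<^sup>+\<^sup>2\<close>; together with
  the Clifford relation this determines it up to isomorphism.
\<close>

theorem clifford_generated:
  assumes "subspace S" "1 \<in> S" "\<And>v x. x \<in> S \<Longrightarrow> vec_clifford v * x \<in> S"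
  shows "S = UNIV"
proof -
  have blade: "blade A \<in> S" for A
  proof (induction A rule: finite_induct[OF finite])
    case 1
    show ?case using assms(2) by (simp add: one_clifford_def)
  next
    case (2 a A)
    obtain v where v: "vec_clifford v = blade {a}" using gen_in_range by blast
    have sd: "sym_diff {a} A = insert a A" using 2 by auto
    have "blade_sign {a} A * blade_sign {a} A = 1"
      by (simp add: blade_sign_def gen_sign_sq flip: prod.distrib)
    then have "blade (insert a A) = blade_sign {a} A *\<^sub>R (vec_clifford v * blade A)"
      by (simp add: v blade_mult sd)
    then show ?case
      using assms 2 by (simp add: subspace_scale)
  qed
  have "x = (\<Sum>A\<in>UNIV. coef x A *\<^sub>R blade A)" for x
  proof -
    have "coef (\<Sum>A\<in>F. coef x A *\<^sub>R blade A) B = (\<Sum>A\<in>F. if B = A then coef x A else 0)" for F B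
      by (induction F rule: infinite_finite_induct)
        (auto simp: zero_clifford.rep_eq plus_clifford.rep_eq scaleR_clifford.rep_eq blade.rep_eq)
    from this[of UNIV] show ?thesis by (simp add: clifford_eq_iff)
  qed
  then have "x \<in> S" for x
    by (metis (no_types, lifting) assms(1) blade subspace_scale subspace_sum)
  then show ?thesis by blast
qed

theorem DIM_clifford: "DIM('n::finite clifford) = 2 ^ (CARD('n) + 2)"
proof -
  have "inj (blade :: ('n + bool) set \<Rightarrow> 'n clifford)"
    by (rule injI) (metis blade.rep_eq zero_neq_one)
  then have "DIM('n clifford) = CARD(('n + bool) set)"
    by (simp add: Basis_clifford_def card_image)
  also have "\<dots> = 2 ^ (CARD('n) + 2)"
    by (simp add: card_UNIV_sum flip: Pow_UNIV add: card_Pow)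
  finally show ?thesis .
qed


section \<open>The spin group\<close>

definition spin_group :: "'n::finite clifford set" where
  "spin_group = {prod_list (map vec_clifford vs) |vs. set vs \<subseteq> unit_spacelike \<and> even (length vs)}"

definition clifford_inv :: "'n::finite clifford \<Rightarrow> 'n clifford" where
  "clifford_inv x = (THE y. x * y = 1 \<and> y * x = 1)"

definition spin_act :: "'n::finite clifford \<Rightarrow> 'n mink \<Rightarrow> 'n mink" where
  "spin_act p v = (THE w. vec_clifford w = clifford_inv p * vec_clifford v * p)"


section \<open>Smooth maps and partial derivatives\<close>

text \<open>The definitions below are meant for open sets.\<close>

primrec Ck_on :: "nat \<Rightarrow> 'a::real_normed_vector set \<Rightarrow> ('a \<Rightarrow> 'b::real_normed_vector) \<Rightarrow> bool" where
  "Ck_on 0 S g \<longleftrightarrow> continuous_on S g"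
| "Ck_on (Suc k) S g \<longleftrightarrow> (\<forall>x\<in>S. g differentiable (at x)) \<and>
     (\<forall>v. Ck_on k S (\<lambda>x. frechet_derivative g (at x) v))"

definition smooth_on :: "'a::real_normed_vector set \<Rightarrow> ('a \<Rightarrow> 'b::real_normed_vector) \<Rightarrow> bool" where
  "smooth_on S g \<longleftrightarrow> (\<forall>k. Ck_on k S g)"

definition pderiv_at ::
  "'m::finite \<Rightarrow> (real ^ 'm \<Rightarrow> 'b::real_normed_vector) \<Rightarrow> real ^ 'm \<Rightarrow> 'b" where
  "pderiv_at j g q = frechet_derivative g (at q) (axis j 1)"


section \<open>Nets and sphere congruences in the conformal sphere\<close>

text \<open>
  A map into the conformal sphere is given by a lift to the light cone. The notions of
  contact, curvature line and flatness do not depend on the choice of the (smooth) lift. The tangent space of the conformal sphere at the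
  null line of \<open>g q\<close> is the quotient of the orthogonal complement of \<open>g q\<close> by this line, so
  the induced map is immersive iff the differential of the lift is injective modulo \<open>g q\<close>.
\<close>

definition conformal_immersion ::
  "(real ^ 'm::finite) set \<Rightarrow> (real ^ 'm \<Rightarrow> 'n::finite mink) \<Rightarrow> bool" where
  "conformal_immersion U g \<longleftrightarrow>
     (\<forall>q\<in>U. \<forall>v. frechet_derivative g (at q) v \<in> span {g q} \<longrightarrow> v = 0)"

definition timelike_subspace :: "'n::finite mink set \<Rightarrow> bool" where
  "timelike_subspace V \<longleftrightarrow> subspace V \<and> (\<exists>v\<in>V. lorentz v v < 0)"

definition k_sphere :: "nat \<Rightarrow> 'n::finite mink set \<Rightarrow> bool" where
  "k_sphere k V \<longleftrightarrow> timelike_subspace V \<and> dim V = k + 2"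

text \<open>
  The coordinate subnet through \<open>p\<close> in which the parameters \<open>t\<^sub>i\<close>, \<open>i \<in> K\<close>, vary.
\<close>

definition subnet_domain ::
  "(real ^ 'm::finite) set \<Rightarrow> 'm set \<Rightarrow> real ^ 'm \<Rightarrow> (real ^ 'm) set" where
  "subnet_domain U K p = {q\<in>U. \<forall>i. i \<notin> K \<longrightarrow> q $ i = p $ i}"

text \<open>
  First order contact of the subnet of \<open>g\<close> with a sphere \<open>V\<close>: the point lies on the sphere and
  the image of the differential lies in the tangent space of the sphere. If the subnet is immersed and
  \<open>V\<close> is a \<open>card K\<close>-sphere, the two tangent spaces then agree by dimension; for a degenerate
  envelope only the inclusion remains.
\<close>

definition first_order_contact ::
  "'m::finite set \<Rightarrow> (real ^ 'm \<Rightarrow> 'n::finite mink) \<Rightarrow> real ^ 'm \<Rightarrow> 'n mink set \<Rightarrow> bool" where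
  "first_order_contact K g q V \<longleftrightarrow> g q \<in> V \<and> (\<forall>i\<in>K. pderiv_at i g q \<in> V)"

definition envelopes ::
  "'m::finite set \<Rightarrow> (real ^ 'm) set \<Rightarrow> (real ^ 'm \<Rightarrow> 'n::finite mink) \<Rightarrow>
   (real ^ 'm \<Rightarrow> 'n mink set) \<Rightarrow> bool" where
  "envelopes K M g s \<longleftrightarrow> (\<forall>q\<in>M. first_order_contact K g q (s q))"

text \<open>
  Tangent and normal space, at the null line of \<open>x\<close>, of the sphere \<open>V\<close> and hence of any
  envelope touching \<open>V\<close> there; both contain the line of \<open>x\<close>, which has to be divided out.
  If \<open>V = s q\<close> is enveloped by \<open>g\<close>, \<open>x = g q\<close>, and \<open>g\<close> is immersed, they are
  the span of \<open>g, \<partial>\<^sub>i g\<close> (\<open>i \<in> K\<close>) and its orthogonal complement. Working with \<open>V\<close> gives them a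
  meaning also where the envelope degenerates.
\<close>

definition tangent_space :: "'n::finite mink set \<Rightarrow> 'n mink \<Rightarrow> 'n mink set" where
  "tangent_space V x = V \<inter> lorentz_perp {x}"

definition normal_space :: "'n::finite mink set \<Rightarrow> 'n mink \<Rightarrow> 'n mink set" where
  "normal_space V x = lorentz_perp (tangent_space V x)"

text \<open>
  The induced metric is \<open>\<langle>\<partial>\<^sub>i g, \<partial>\<^sub>j g\<rangle>\<close> and the second fundamental form in the normal
  direction \<open>N\<close> is \<open>\<langle>N, \<partial>\<^sub>i \<partial>\<^sub>j g\<rangle>\<close>. Adding a multiple of \<open>g\<close> to \<open>N\<close> adds a multiple of
  the metric, which does not change the eigendirections of the shape operator.
\<close>

definition principal_direction ::
  "'m::finite set \<Rightarrow> (real ^ 'm \<Rightarrow> 'n::finite mink) \<Rightarrow> real ^ 'm \<Rightarrow> 'n mink \<Rightarrow> 'm \<Rightarrow> bool" where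
  "principal_direction K g q N i \<longleftrightarrow>
     (\<exists>\<kappa>. \<forall>j\<in>K. lorentz N (pderiv_at i (pderiv_at j g) q)
                 = \<kappa> * lorentz (pderiv_at i g q) (pderiv_at j g q))"

text \<open>
  Flatness of the normal bundle of the envelope \<open>g\<close>: any normal vector extends locally to a
  normal field \<open>N\<close> that is parallel, i.e. whose derivatives are tangential.
\<close>

definition flat_normal_bundle ::
  "'m::finite set \<Rightarrow> (real ^ 'm) set \<Rightarrow> (real ^ 'm \<Rightarrow> 'n::finite mink) \<Rightarrow>
   (real ^ 'm \<Rightarrow> 'n mink set) \<Rightarrow> bool" where
  "flat_normal_bundle K M g s \<longleftrightarrow>
     (\<forall>q\<in>M. \<forall>w\<in>normal_space (s q) (g q). \<exists>r>0. \<exists>N. smooth_on (ball q r) N \<and> N q = w \<and>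
        (\<forall>x\<in>M \<inter> ball q r. N x \<in> normal_space (s x) (g x) \<and>
           (\<forall>i\<in>K. pderiv_at i N x \<in> tangent_space (s x) (g x))))"

text \<open>
  The coordinate lines of the envelope \<open>g\<close> are curvature lines: they are orthogonal and principal
  for all normal directions.
\<close>

definition coordinate_curvature_lines ::
  "'m::finite set \<Rightarrow> (real ^ 'm) set \<Rightarrow> (real ^ 'm \<Rightarrow> 'n::finite mink) \<Rightarrow>
   (real ^ 'm \<Rightarrow> 'n mink set) \<Rightarrow> bool" where
  "coordinate_curvature_lines K M g s \<longleftrightarrow>
     (\<forall>q\<in>M. \<forall>i\<in>K.
        (\<forall>j\<in>K. i \<noteq> j \<longrightarrow> lorentz (pderiv_at i g q) (pderiv_at j g q) = 0) \<and>
        (\<forall>N\<in>normal_space (s q) (g q). principal_direction K g q N i))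
     \<and> flat_normal_bundle K M g s"

text \<open>
  The curvature lines of the two envelopes correspond: in both cases they are the coordinate lines.
\<close>

definition ribaucour_congruence ::
  "'m::finite set \<Rightarrow> (real ^ 'm) set \<Rightarrow> (real ^ 'm \<Rightarrow> 'n::finite mink set) \<Rightarrow>
   (real ^ 'm \<Rightarrow> 'n mink) \<Rightarrow> (real ^ 'm \<Rightarrow> 'n mink) \<Rightarrow> bool" where
  "ribaucour_congruence K M s f fh \<longleftrightarrow>
     (\<forall>q\<in>M. k_sphere (card K) (s q)) \<and> envelopes K M f s \<and> envelopes K M fh s \<and>
     coordinate_curvature_lines K M f s \<and> coordinate_curvature_lines K M fh s"

definition ribaucour_pair ::
  "(real ^ 'm::finite) set \<Rightarrow> (real ^ 'm \<Rightarrow> 'n::finite mink) \<Rightarrow> (real ^ 'm \<Rightarrow> 'n mink) \<Rightarrow> bool" where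
  "ribaucour_pair U f fh \<longleftrightarrow>
     smooth_on U f \<and> f ` U \<subseteq> light_cone \<and> smooth_on U fh \<and> fh ` U \<subseteq> light_cone \<and>
     (conformal_immersion U f \<or> conformal_immersion U fh) \<and>
     (\<forall>K p. K \<noteq> {} \<and> p \<in> U \<longrightarrow> (\<exists>s. ribaucour_congruence K (subnet_domain U K p) s f fh))"


section \<open>Adapted frames\<close>

text \<open>
  The indices \<open>1, \<dots>, m\<close> are the elements of the type \<open>'m\<close>. They are regarded as indices in
  \<open>'n\<close> by means of an injection \<open>\<iota>\<close>; the indices \<open>m + 1, \<dots>, n\<close> are those in
  \<open>- range \<iota>\<close>.
\<close>

definition parallel_section ::
  "(real ^ 'm::finite) set \<Rightarrow> (real ^ 'm \<Rightarrow> 'n::finite mink set) \<Rightarrow> (real ^ 'm \<Rightarrow> 'n mink) \<Rightarrow> bool" where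
  \<comment> \<open>the orthogonal projections of the derivatives to the nondegenerate bundle \<open>W\<close> vanish\<close>
  "parallel_section U W N \<longleftrightarrow>
     (\<forall>q\<in>U. N q \<in> W q \<and> (\<forall>j. pderiv_at j N q \<in> lorentz_perp (W q)))"

definition orthonormal_basis :: "'i set \<Rightarrow> ('i \<Rightarrow> 'n::finite mink) \<Rightarrow> 'n mink set \<Rightarrow> bool" where
  "orthonormal_basis I b W \<longleftrightarrow>
     (\<forall>i\<in>I. \<forall>j\<in>I. lorentz (b i) (b j) = (if i = j then 1 else 0)) \<and> span (b ` I) = W"

definition adapted_frame ::
  "('m::finite \<Rightarrow> 'n::finite) \<Rightarrow> (real ^ 'm) set \<Rightarrow> (real ^ 'm \<Rightarrow> 'n clifford) \<Rightarrow>
   (real ^ 'm \<Rightarrow> 'n mink) \<Rightarrow> (real ^ 'm \<Rightarrow> 'n mink) \<Rightarrow> bool" where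
  "adapted_frame \<iota> U \<Phi> f fh \<longleftrightarrow>
     (let s = (\<lambda>i q. spin_act (\<Phi> q) (e_space i));
          W = (\<lambda>q. lorentz_perp ({f q, fh q} \<union> (\<lambda>i. s (\<iota> i) q) ` UNIV)) in
     (\<forall>q\<in>U. f q = spin_act (\<Phi> q) e_zero \<and> fh q = spin_act (\<Phi> q) e_infty) \<and>
     (\<forall>q\<in>U. \<forall>j. lorentz (pderiv_at j f q) (fh q) = 0) \<and>
     (\<forall>q\<in>U. \<forall>j. pderiv_at j f q \<in> span {s (\<iota> j) q} \<and> pderiv_at j fh q \<in> span {s (\<iota> j) q}) \<and>
     (\<forall>q\<in>U. orthonormal_basis (- range \<iota>) (\<lambda>i. s i q) (W q)) \<and>
     (\<forall>i\<in>- range \<iota>. parallel_section U W (s i)))"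

end

theory Submission
  imports Defs
begin

text \<open>
  Write \<open>F v = \<Phi>\<^sup>-\<^sup>1 v \<Phi>\<close>. For orthogonal \<open>w\<close> and \<open>e\<close>, the equation
  \<open>\<partial>\<^sub>j \<Phi> = w e \<Phi>\<close> is equivalent to
  \<open>\<partial>\<^sub>j (F v) = F (2 \<langle>v, e\<rangle> w - 2 \<langle>v, w\<rangle> e)\<close> for all \<open>v\<close>: the latter determines
  \<open>\<partial>\<^sub>j \<Phi> \<cdot> \<Phi>\<^sup>-\<^sup>1\<close> up to a central element, which is a scalar by parity and
  vanishes as it changes sign under reversion. With \<open>e = e\<^sub>j\<close> the latter says that the
  skew form \<open>\<langle>\<partial>\<^sub>j (F v), F u\<rangle>\<close> vanishes for all basis vectors \<open>v, u \<noteq> e\<^sub>j\<close>. The only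
  components for which an adapted frame does not give this directly are
  \<open>\<langle>\<partial>\<^sub>j s\<^sub>i, s\<^sub>k\<rangle>\<close> with \<open>k \<le> m\<close>; they vanish because \<open>s\<^sub>i\<close> is normal to the 2-sphere of the
  \<open>(t\<^sub>j, t\<^sub>k)\<close>-subnet, whose coordinate lines are curvature lines. Conversely, the equation makes the
  normal fields with constant coefficients in the frame parallel, for all coordinate subnets.
\<close>

section \<open>Reversion, parity and the centre of the Clifford algebra\<close>

lemma coef_simps [simp]:
  "coef 0 A = 0" "coef (x + y) A = coef x A + coef y A" "coef (x - y) A = coef x A - coef y A"
  "coef (- x) A = - coef x A" "coef (r *\<^sub>R x) A = r * coef x A"
  by (simp_all add: zero_clifford.rep_eq plus_clifford.rep_eq minus_clifford.rep_eq
      uminus_clifford.rep_eq scaleR_clifford.rep_eq)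

lemma coef_sum: "coef (sum g I) A = (\<Sum>i\<in>I. coef (g i) A)"
  by (induction I rule: infinite_finite_induct) auto

lemma coef_blade_mult:
  "coef (blade B * x) C = blade_sign B (sym_diff B C) * coef x (sym_diff B C)"
proof -
  have "coef (blade B * x) C
      = (\<Sum>A\<in>UNIV. if A = B then blade_sign A (sym_diff A C) * coef x (sym_diff A C) else 0)"
    unfolding times_clifford.rep_eq blade.rep_eq by (rule sum.cong) auto
  then show ?thesis by simp
qed

lemma coef_mult_blade:
  "coef (x * blade B) C = blade_sign (sym_diff B C) B * coef x (sym_diff B C)"
proof -
  have "coef (x * blade B) C
      = (\<Sum>A\<in>UNIV. if A = sym_diff B C then blade_sign A B * coef x A else 0)"
    unfolding times_clifford.rep_eq blade.rep_eq
  proof (rule sum.cong[OF refl])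
    fix A :: "('a + bool) set"
    have "sym_diff A C = B \<longleftrightarrow> A = sym_diff B C" by auto
    then show "blade_sign A (sym_diff A C) * coef x A * (if sym_diff A C = B then 1 else 0)
        = (if A = sym_diff B C then blade_sign A B * coef x A else 0)"
      by (cases "sym_diff A C = B") simp_all
  qed
  then show ?thesis by simp
qed

lemma blade_sign_swap:
  "blade_sign {a} A = (- 1) ^ card (A - {a}) * blade_sign A {a}"
proof -
  have "gen_sign a b = (if b = a then 1 else - 1) * gen_sign b a" for b
    by (auto simp: gen_sign_def dest: inj_onD[OF inj_to_nat])
  then have "blade_sign {a} A = (\<Prod>b\<in>A. if b = a then 1 else - 1) * blade_sign A {a}"
    by (simp add: blade_sign_def flip: prod.distrib)
  also have "(\<Prod>b\<in>A. if b = a then 1 else - 1 :: real) = (- 1) ^ card (A - {a})"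
    by (simp add: prod.If_cases Diff_eq Compl_eq)
  finally show ?thesis .
qed

lemma blade_sign_nonzero [simp]: "blade_sign A B \<noteq> 0"
proof -
  have "gen_sign a b \<noteq> 0" for a b :: "'a + bool"
    using gen_sign_sq[of a b] by auto
  then show ?thesis by (simp add: blade_sign_def)
qed

lift_definition reversion :: "'n::finite clifford \<Rightarrow> 'n clifford"
  is "\<lambda>x A. (- 1) ^ (card A choose 2) * x A" .

lemma linear_reversion: "linear reversion"
  by (rule linearI) (auto simp: clifford_eq_iff reversion.rep_eq algebra_simps)

lemma reversion_1 [simp]: "reversion 1 = 1"
  by (auto simp: clifford_eq_iff reversion.rep_eq one_clifford_def blade.rep_eq binomial_eq_0)

lemma reversion_reversion [simp]: "reversion (reversion x) = x"
  by (auto simp: clifford_eq_iff reversion.rep_eq simp flip: mult.assoc power_add)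

lemma reversion_blade_mult: "reversion (blade {a} * x) = reversion x * blade {a}"
proof -
  have "(- 1) ^ (card C choose 2) * blade_sign {a} B = (- 1) ^ (card B choose 2) * blade_sign B {a}"
    if "B = sym_diff {a} C" for B C
  proof -
    have "(- 1 :: real) ^ (card C choose 2) * (- 1) ^ card (B - {a}) = (- 1) ^ (card B choose 2)"
    proof (cases "a \<in> B")
      case True
      then have C: "C = B - {a}" using that by auto
      then have "card B = Suc (card C)" using True card_Suc_Diff1[of B a] by simp
      then have "card B choose 2 = card C + (card C choose 2)" by (simp add: numeral_2_eq_2)
      then show ?thesis using C by (simp add: power_add mult.commute)
    next
      case False
      then have C: "C = insert a B" using that by auto
      then have "card C choose 2 = card B + (card B choose 2)"
        using False by (simp add: numeral_2_eq_2)
      moreover have "(- 1 :: real) ^ card B * (- 1) ^ card B = 1"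
        by (simp flip: power_add)
      ultimately show ?thesis using False by (simp add: power_add)
    qed
    then show ?thesis by (simp add: blade_sign_swap[of a B])
  qed
  then show ?thesis
    by (simp add: clifford_eq_iff reversion.rep_eq coef_blade_mult coef_mult_blade mult_ac)
qed

lemma linear_vec_clifford: "linear vec_clifford"
proof -
  have "gen_coord (v + w) a = gen_coord v a + gen_coord w a"
    and "gen_coord (r *\<^sub>R v) a = r * gen_coord v a" for v w :: "'a mink" and r a
    by (auto simp: gen_coord_def field_simps split: sum.splits)
  then show ?thesis
    by (intro linearI)
      (simp_all add: vec_clifford_eq scaleR_left_distrib sum.distrib scaleR_sum_right)
qed

lemma coef_vec_clifford: "coef (vec_clifford v) {a} = gen_coord v a"
  by (simp add: vec_clifford_eq coef_sum blade.rep_eq if_distrib[of "\<lambda>t. _ * t"] cong: if_cong)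

lemma inj_vec_clifford: "inj vec_clifford"
proof (rule injI)
  fix v w :: "'a mink"
  assume "vec_clifford v = vec_clifford w"
  then have "gen_coord v a = gen_coord w a" for a
    by (metis coef_vec_clifford)
  from this[of "Inl i" for i] this[of "Inr False"] this[of "Inr True"] show "v = w"
    by (auto simp: gen_coord_def prod_eq_iff vec_eq_iff)
qed

lemma vec_clifford_eq_iff [simp]: "vec_clifford v = vec_clifford w \<longleftrightarrow> v = w"
  using inj_vec_clifford by (auto dest: injD)

lemma reversion_vec_mult: "reversion (vec_clifford v * x) = reversion x * vec_clifford v"
  by (simp add: vec_clifford_eq sum_distrib_right sum_distrib_left linear_sum[OF linear_reversion]
      linear_cmul[OF linear_reversion] reversion_blade_mult)

lemma reversion_vec [simp]: "reversion (vec_clifford v) = vec_clifford v"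
  using reversion_vec_mult[of v 1] by simp

theorem reversion_mult: "reversion (x * y) = reversion y * reversion x"
proof -
  let ?S = "{x. \<forall>y. reversion (x * y) = reversion y * reversion x}"
  have "?S = UNIV"
    by (rule clifford_generated)
      (auto simp: subspace_def algebra_simps linear_0[OF linear_reversion]
        linear_add[OF linear_reversion] linear_cmul[OF linear_reversion] mult.assoc
        reversion_vec_mult)
  then show ?thesis by blast
qed

definition clifford_even :: "'n::finite clifford set" where
  "clifford_even = {x. \<forall>A. odd (card A) \<longrightarrow> coef x A = 0}"

lemma subspace_clifford_even: "subspace clifford_even"
  by (auto simp: subspace_def clifford_even_def)

lemma one_clifford_even: "1 \<in> clifford_even"
  by (auto simp: clifford_even_def one_clifford_def blade.rep_eq)

lemma even_card_sym_diff:
  fixes A B :: "'a::finite set"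
  shows "even (card (sym_diff A B)) \<longleftrightarrow> (even (card A) \<longleftrightarrow> even (card B))"
proof -
  have "card (sym_diff A B) = card (A - B) + card (B - A)"
    by (rule card_Un_disjoint) auto
  moreover have "card A = card (A - B) + card (A \<inter> B)" "card B = card (B - A) + card (B \<inter> A)"
    by (subst card_Un_disjoint[symmetric]; auto intro: arg_cong[where f = card])+
  ultimately show ?thesis by (simp add: Int_commute) blast
qed

lemma clifford_even_mult:
  assumes "x \<in> clifford_even" "y \<in> clifford_even"
  shows "x * y \<in> clifford_even"
proof -
  have "coef x A * coef y (sym_diff A C) = 0" if "odd (card C)" for A C
  proof (cases "even (card A)")
    case True
    then have "odd (card (sym_diff A C))" using that by (simp only: even_card_sym_diff) simp
    then show ?thesis using assms by (simp add: clifford_even_def)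
  next
    case False
    then show ?thesis using assms by (simp add: clifford_even_def)
  qed
  then have "coef (x * y) C = 0" if "odd (card C)" for C
    using that unfolding times_clifford.rep_eq mult.assoc by (intro sum.neutral ballI) auto
  then show ?thesis by (simp add: clifford_even_def)
qed

lemma vec_mult_vec_even: "vec_clifford v * vec_clifford w \<in> clifford_even"
proof -
  have "blade {a} * blade {b} \<in> clifford_even" for a b :: "'a + bool"
    using even_card_sym_diff[of "{a}" "{b}"]
    by (auto simp: blade_mult clifford_even_def blade.rep_eq)
  then show ?thesis
    unfolding vec_clifford_eq sum_product
    by (auto intro!: subspace_sum[OF subspace_clifford_even]
        subspace_scale[OF subspace_clifford_even])
qed

lemma reversion_even: "x \<in> clifford_even \<Longrightarrow> reversion x \<in> clifford_even"
  by (simp add: clifford_even_def reversion.rep_eq)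

text \<open>
  Without the parity assumption the statement fails for odd \<open>n\<close>, where the product of all
  generators is central.
\<close>

lemma even_central_scalar:
  assumes "x \<in> clifford_even" and comm: "\<And>v. vec_clifford v * x = x * vec_clifford v"
  shows "\<exists>c. x = c *\<^sub>R 1"
proof -
  have "coef x A = 0" if "A \<noteq> {}" for A
  proof (cases "even (card A)")
    case True
    from \<open>A \<noteq> {}\<close> obtain a where a: "a \<in> A" by blast
    then have "odd (card (A - {a}))" using True
      by (metis card_Suc_Diff1 even_Suc finite)
    then have sgn: "blade_sign {a} A = - blade_sign A {a}" by (simp add: blade_sign_swap)
    obtain v where "vec_clifford v = blade {a}" using gen_in_range by blast
    then have "coef (blade {a} * x) (sym_diff {a} A) = coef (x * blade {a}) (sym_diff {a} A)"
      using comm[of v] by simp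
    moreover have "sym_diff {a} (sym_diff {a} A) = A" by auto
    ultimately show ?thesis unfolding coef_blade_mult coef_mult_blade by (simp add: sgn)
  qed (use assms(1) in \<open>simp add: clifford_even_def\<close>)
  then have "x = coef x {} *\<^sub>R 1"
    by (auto simp: clifford_eq_iff one_clifford_def blade.rep_eq)
  then show ?thesis by blast
qed


section \<open>The action of the spin group\<close>

lemma bilinear_lorentz: "bilinear lorentz"
  unfolding bilinear_def
  by (intro conjI allI linearI)
    (auto simp: lorentz_def inner_simps algebra_simps diff_divide_distrib add_divide_distrib)

lemmas lorentz_simps [simp] =
  bilinear_ladd[OF bilinear_lorentz] bilinear_radd[OF bilinear_lorentz]
  bilinear_lmul[OF bilinear_lorentz] bilinear_rmul[OF bilinear_lorentz]
  bilinear_lsub[OF bilinear_lorentz] bilinear_rsub[OF bilinear_lorentz]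
  bilinear_lneg[OF bilinear_lorentz] bilinear_rneg[OF bilinear_lorentz]
  bilinear_lzero[OF bilinear_lorentz] bilinear_rzero[OF bilinear_lorentz]

lemma lorentz_commute: "lorentz v w = lorentz w v"
  by (simp add: lorentz_def inner_commute mult.commute add.commute)

lemma mink_basis_expansion:
  "v = fst v *\<^sub>R e_zero + (\<Sum>i\<in>UNIV. (fst (snd v) $ i) *\<^sub>R e_space i) + snd (snd v) *\<^sub>R e_infty"
proof -
  have "(\<Sum>i\<in>UNIV. (fst (snd v) $ i) *\<^sub>R e_space i) = (0, \<Sum>i\<in>UNIV. (fst (snd v) $ i) *\<^sub>R axis i 1, 0)"
    by (simp add: e_space_def prod_eq_iff fst_sum snd_sum)
  also have "(\<Sum>i\<in>UNIV. (fst (snd v) $ i) *\<^sub>R axis i 1) = fst (snd v)"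
    using basis_expansion[of "fst (snd v)"] by (simp add: scalar_mult_eq_scaleR)
  finally show ?thesis by (simp add: e_zero_def e_infty_def prod_eq_iff)
qed

lemma mink_subspace_UNIV:
  assumes "subspace S" "e_zero \<in> S" "e_infty \<in> S" "\<And>i. e_space i \<in> S"
  shows "v \<in> S"
  by (subst mink_basis_expansion)
    (intro subspace_add subspace_sum subspace_scale assms)

lemma lorentz_nondegenerate:
  assumes "\<And>u. lorentz v u = lorentz w u"
  shows "v = w"
proof -
  have "fst (snd v) $ i = fst (snd w) $ i" for i
    using assms[of "e_space i"] by (simp add: lorentz_def e_space_def inner_axis)
  then show ?thesis
    using assms[of e_zero] assms[of e_infty]
    by (simp add: prod_eq_iff vec_eq_iff lorentz_def e_zero_def e_infty_def)
qed

lemma vec_clifford_sq: "vec_clifford s * vec_clifford s = (- lorentz s s) *\<^sub>R 1"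
  using arg_cong[OF clifford_relation[of s s], of "\<lambda>x. (1 / 2) *\<^sub>R x"]
  by (simp flip: scaleR_2)

lemma reflection_clifford:
  assumes "s \<in> unit_spacelike"
  shows "vec_clifford s * vec_clifford v * vec_clifford s
    = vec_clifford (v - (2 * lorentz v s) *\<^sub>R s)"
proof -
  have sq: "vec_clifford s * vec_clifford s = - 1"
    using assms by (simp add: vec_clifford_sq unit_spacelike_def)
  have "vec_clifford s * vec_clifford v = - (vec_clifford v * vec_clifford s) - (2 * lorentz v s) *\<^sub>R 1"
    using clifford_relation[of s v] by (simp add: eq_diff_eq[symmetric] lorentz_commute[of s v])
  then have "vec_clifford s * vec_clifford v * vec_clifford s
      = - (vec_clifford v * (vec_clifford s * vec_clifford s)) - (2 * lorentz v s) *\<^sub>R vec_clifford s"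
    by (simp add: left_diff_distrib mult.assoc)
  then show ?thesis
    by (simp add: sq linear_diff[OF linear_vec_clifford] linear_cmul[OF linear_vec_clifford])
qed

lemma reversion_prod_list_vec:
  fixes vs :: "'n::finite mink list"
  defines "p \<equiv> prod_list (map vec_clifford vs)"
  assumes "set vs \<subseteq> unit_spacelike"
  shows "p * reversion p = (- 1) ^ length vs \<and> reversion p * p = (- 1) ^ length vs"
  using assms(2) unfolding p_def
proof (induction vs)
  case (Cons s vs)
  let ?p = "prod_list (map vec_clifford vs)"
  have sq: "vec_clifford s * vec_clifford s = - 1"
    using Cons.prems by (simp add: vec_clifford_sq unit_spacelike_def)
  have comm: "x * (- 1) ^ k = (- 1) ^ k * x" for x :: "'n clifford" and k :: nat
    by (cases "even k") auto
  have "vec_clifford s * ?p * (reversion ?p * vec_clifford s)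
      = vec_clifford s * (?p * reversion ?p) * vec_clifford s"
    by (simp only: mult.assoc)
  also have "\<dots> = (- 1) ^ length vs * (vec_clifford s * vec_clifford s)"
    using Cons by (simp add: comm mult.assoc)
  finally have 1: "vec_clifford s * ?p * (reversion ?p * vec_clifford s) = (- 1) ^ length (s # vs)"
    by (simp add: sq)
  have "reversion ?p * vec_clifford s * (vec_clifford s * ?p)
      = reversion ?p * (vec_clifford s * vec_clifford s) * ?p"
    by (simp only: mult.assoc)
  then have "reversion ?p * vec_clifford s * (vec_clifford s * ?p) = (- 1) ^ length (s # vs)"
    using Cons by (simp add: sq)
  then show ?case using 1 by (simp add: reversion_vec_mult)
qed simp

lemma spin_group_reversion:
  assumes "p \<in> spin_group"
  shows "p * reversion p = 1" "reversion p * p = 1"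
proof -
  obtain vs where "p = prod_list (map vec_clifford vs)" "set vs \<subseteq> unit_spacelike" "even (length vs)"
    using assms by (auto simp: spin_group_def)
  then show "p * reversion p = 1" "reversion p * p = 1"
    using reversion_prod_list_vec[of vs] by simp_all
qed

lemma spin_group_even:
  assumes "p \<in> spin_group"
  shows "p \<in> clifford_even"
proof -
  have "prod_list (map vec_clifford vs) \<in> clifford_even" if "even (length vs)" for vs :: "'a mink list"
    using that
  proof (induction vs rule: induct_list012)
    case (3 s t vs)
    then have "(vec_clifford s * vec_clifford t) * prod_list (map vec_clifford vs) \<in> clifford_even"
      by (intro clifford_even_mult vec_mult_vec_even) auto
    then show ?case by (simp add: mult.assoc)
  qed (auto simp: one_clifford_even)
  then show ?thesis using assms by (auto simp: spin_group_def)
qed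

lemma clifford_inv_spin:
  assumes "p \<in> spin_group"
  shows "clifford_inv p = reversion p"
  unfolding clifford_inv_def
proof (rule the_equality)
  fix y assume "p * y = 1 \<and> y * p = 1"
  then show "y = reversion p"
    using spin_group_reversion[OF assms] by (metis mult.assoc mult_1_left mult_1_right)
qed (simp add: spin_group_reversion assms)

lemma vec_clifford_spin_act:
  assumes "p \<in> spin_group"
  shows "vec_clifford (spin_act p v) = reversion p * vec_clifford v * p"
proof -
  have "\<exists>w. vec_clifford w
      = reversion (prod_list (map vec_clifford vs)) * vec_clifford v * prod_list (map vec_clifford vs)"
    if "set vs \<subseteq> unit_spacelike" for vs :: "'a mink list" and v
    using that
  proof (induction vs arbitrary: v)
    case (Cons s vs)
    let ?p = "prod_list (map vec_clifford vs)"
    have "reversion ?p * vec_clifford s * vec_clifford v * (vec_clifford s * ?p)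
        = reversion ?p * (vec_clifford s * vec_clifford v * vec_clifford s) * ?p"
      by (simp add: mult.assoc)
    then show ?case using Cons by (simp add: reversion_vec_mult reflection_clifford)
  qed auto
  moreover obtain vs where "p = prod_list (map vec_clifford vs)" "set vs \<subseteq> unit_spacelike"
    using assms by (auto simp: spin_group_def)
  ultimately obtain w where w: "vec_clifford w = reversion p * vec_clifford v * p"
    by blast
  then show ?thesis
    unfolding spin_act_def clifford_inv_spin[OF assms] w[symmetric]
    by (simp only: vec_clifford_eq_iff the_eq_trivial)
qed

lemma linear_spin_act:
  assumes "p \<in> spin_group"
  shows "linear (spin_act p)"
proof (rule linearI)
  fix v w r
  have "vec_clifford (spin_act p (v + w)) = vec_clifford (spin_act p v + spin_act p w)"
    by (simp add: linear_add[OF linear_vec_clifford] vec_clifford_spin_act[OF assms] algebra_simps)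
  then show "spin_act p (v + w) = spin_act p v + spin_act p w" by simp
  have "vec_clifford (spin_act p (r *\<^sub>R v)) = vec_clifford (r *\<^sub>R spin_act p v)"
    by (simp add: linear_cmul[OF linear_vec_clifford] vec_clifford_spin_act[OF assms])
  then show "spin_act p (r *\<^sub>R v) = r *\<^sub>R spin_act p v" by simp
qed

lemma lorentz_spin_act [simp]:
  assumes "p \<in> spin_group"
  shows "lorentz (spin_act p v) (spin_act p w) = lorentz v w"
proof -
  let ?v = "vec_clifford v" and ?w = "vec_clifford w"
  have m: "(reversion p * x * p) * (reversion p * y * p) = reversion p * (x * y) * p" for x y
    using spin_group_reversion[OF assms] by (metis mult.assoc mult_1_left)
  have "(- 2 * lorentz (spin_act p v) (spin_act p w)) *\<^sub>R 1 = reversion p * (?v * ?w + ?w * ?v) * p"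
    unfolding clifford_relation[symmetric] vec_clifford_spin_act[OF assms] m
    by (simp add: algebra_simps)
  also have "\<dots> = (- 2 * lorentz v w) *\<^sub>R 1"
    unfolding clifford_relation by (simp add: spin_group_reversion assms)
  finally show ?thesis by simp
qed

lemma bij_spin_act:
  assumes "p \<in> spin_group"
  shows "bij (spin_act p)"
proof -
  have "inj (spin_act p)"
    by (rule injI) (metis assms lorentz_nondegenerate lorentz_spin_act)
  then show ?thesis
    by (simp add: bij_def linear_injective_imp_surjective linear_spin_act assms)
qed

section \<open>Calculus of smooth maps\<close>

lemma Ck_on_SucD: "Ck_on (Suc k) S g \<Longrightarrow> Ck_on k S g"
proof (induction k arbitrary: g)
  case 0
  then show ?case
    by (auto intro!: continuous_at_imp_continuous_on differentiable_imp_continuous_within)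
next
  case (Suc k)
  then show ?case using Ck_on.simps(2) by blast
qed

lemma Ck_on_subset: "Ck_on k S g \<Longrightarrow> T \<subseteq> S \<Longrightarrow> Ck_on k T g"
  by (induction k arbitrary: g) (auto intro: continuous_on_subset)

lemma Ck_on_cong:
  assumes "open S" "\<And>x. x \<in> S \<Longrightarrow> g x = h x" "Ck_on k S g"
  shows "Ck_on k S h"
  using assms(2,3)
proof (induction k arbitrary: g h)
  case 0
  then show ?case by (simp cong: continuous_on_cong)
next
  case (Suc k)
  have diff: "g differentiable (at x)" if "x \<in> S" for x
    using Suc.prems that by simp
  have "h differentiable (at x)" if x: "x \<in> S" for x
  proof -
    obtain D where "(g has_derivative D) (at x)"
      using diff[OF x] unfolding differentiable_def by blast
    then have "(h has_derivative D) (at x)"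
      by (rule has_derivative_transform_within_open[OF _ assms(1) x Suc.prems(1)])
    then show ?thesis unfolding differentiable_def by blast
  qed
  moreover have eq: "frechet_derivative g (at x) = frechet_derivative h (at x)" if "x \<in> S" for x
    by (rule frechet_derivative_transform_within_open[OF diff[OF that] assms(1) that Suc.prems(1)])
  have "Ck_on k S (\<lambda>x. frechet_derivative h (at x) v)" for v
  proof (rule Suc.IH)
    show "frechet_derivative g (at x) v = frechet_derivative h (at x) v" if "x \<in> S" for x
      by (simp only: eq[OF that])
    show "Ck_on k S (\<lambda>x. frechet_derivative g (at x) v)"
      using Suc.prems(2) by simp
  qed
  ultimately show ?case by simp
qed

lemma Ck_on_linear:
  assumes "bounded_linear L" "open S" "Ck_on k S g"
  shows "Ck_on k S (\<lambda>x. L (g x))"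
  using assms(3)
proof (induction k arbitrary: g)
  case 0
  then show ?case
    by (auto intro: linear_continuous_on_compose bounded_linear.continuous_on[OF assms(1)])
next
  case (Suc k)
  have der: "((\<lambda>x. L (g x)) has_derivative (\<lambda>v. L (frechet_derivative g (at x) v))) (at x)"
    if "x \<in> S" for x
    using bounded_linear.has_derivative[OF assms(1)] Suc.prems that
    by (auto simp: frechet_derivative_works)
  have "Ck_on k S (\<lambda>x. frechet_derivative (\<lambda>x. L (g x)) (at x) v)" for v
    by (rule Ck_on_cong[OF assms(2), of "\<lambda>x. L (frechet_derivative g (at x) v)"])
      (use Suc frechet_derivative_at[OF der] in \<open>auto simp: fun_eq_iff\<close>)
  then show ?case using der by (auto simp: differentiable_def)
qed

lemma Ck_on_add:
  assumes "open S" "Ck_on k S g" "Ck_on k S h"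
  shows "Ck_on k S (\<lambda>x. g x + h x)"
  using assms(2,3)
proof (induction k arbitrary: g h)
  case 0
  then show ?case by (auto intro: continuous_on_add)
next
  case (Suc k)
  have der: "((\<lambda>x. g x + h x) has_derivative
      (\<lambda>v. frechet_derivative g (at x) v + frechet_derivative h (at x) v)) (at x)"
    if "x \<in> S" for x
    by (rule has_derivative_add) (use Suc.prems that in \<open>auto simp: frechet_derivative_works\<close>)
  have "Ck_on k S (\<lambda>x. frechet_derivative (\<lambda>x. g x + h x) (at x) v)" for v
    by (rule Ck_on_cong[OF assms(1),
          of "\<lambda>x. frechet_derivative g (at x) v + frechet_derivative h (at x) v"])
      (use Suc frechet_derivative_at[OF der] in \<open>auto simp: fun_eq_iff\<close>)
  then show ?case using der by (auto simp: differentiable_def)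
qed

lemma (in bounded_bilinear) Ck_on:
  assumes "open S" "Ck_on k S g" "Ck_on k S h"
  shows "Ck_on k S (\<lambda>x. prod (g x) (h x))"
  using assms(2,3)
proof (induction k arbitrary: g h)
  case 0
  then show ?case by (auto intro: continuous_on)
next
  case (Suc k)
  have der: "((\<lambda>x. prod (g x) (h x)) has_derivative
      (\<lambda>v. prod (g x) (frechet_derivative h (at x) v) + prod (frechet_derivative g (at x) v) (h x)))
      (at x)" if "x \<in> S" for x
    by (rule FDERIV) (use Suc.prems that in \<open>auto simp: frechet_derivative_works\<close>)
  have "Ck_on k S (\<lambda>x. frechet_derivative (\<lambda>x. prod (g x) (h x)) (at x) v)" for v
  proof (rule Ck_on_cong[OF assms(1)])
    show "Ck_on k S (\<lambda>x. prod (g x) (frechet_derivative h (at x) v)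
        + prod (frechet_derivative g (at x) v) (h x))"
      using Suc.prems
      by (intro Ck_on_add[OF assms(1)] Suc.IH) (auto intro: Ck_on_SucD simp del: Ck_on.simps, auto)
  qed (use frechet_derivative_at[OF der] in \<open>auto simp: fun_eq_iff\<close>)
  then show ?case using der by (auto simp: differentiable_def)
qed

lemma smooth_on_differentiable: "smooth_on S g \<Longrightarrow> x \<in> S \<Longrightarrow> g differentiable (at x)"
  unfolding smooth_on_def using Ck_on.simps(2) by blast

lemma smooth_on_pderiv_at: "smooth_on S g \<Longrightarrow> smooth_on S (pderiv_at j g)"
  unfolding smooth_on_def pderiv_at_def[abs_def] using Ck_on.simps(2) by blast

lemma pderiv_at_cong:
  assumes "open S" "x \<in> S" "\<And>y. y \<in> S \<Longrightarrow> g y = h y" "g differentiable (at x)"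
  shows "pderiv_at j g x = pderiv_at j h x"
  unfolding pderiv_at_def
  using frechet_derivative_transform_within_open[OF assms(4,1,2,3)] by simp

lemma pderiv_at_const [simp]: "pderiv_at j (\<lambda>x. c) x = 0"
  by (simp add: pderiv_at_def)

lemma pderiv_at_linear:
  assumes "bounded_linear L" "g differentiable (at x)"
  shows "pderiv_at j (\<lambda>x. L (g x)) x = L (pderiv_at j g x)"
  using frechet_derivative_at[OF bounded_linear.has_derivative[OF assms(1)
        assms(2)[unfolded frechet_derivative_works]]]
  by (simp add: pderiv_at_def fun_eq_iff)

lemma (in bounded_bilinear) differentiable:
  assumes "g differentiable (at x)" "h differentiable (at x)"
  shows "(\<lambda>x. prod (g x) (h x)) differentiable (at x)"
  using assms FDERIV unfolding differentiable_def by blast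

lemma (in bounded_bilinear) pderiv_at:
  assumes "g differentiable (at x)" "h differentiable (at x)"
  shows "pderiv_at j (\<lambda>x. prod (g x) (h x)) x
    = prod (pderiv_at j g x) (h x) + prod (g x) (pderiv_at j h x)"
  using frechet_derivative_at[OF FDERIV[OF assms[unfolded frechet_derivative_works]]]
  by (simp add: pderiv_at_def fun_eq_iff add.commute)

lemma bounded_bilinear_clifford_mult:
  "bounded_bilinear ((*) :: 'n::finite clifford \<Rightarrow> _)"
  by (auto simp: bilinear_conv_bounded_bilinear[symmetric] bilinear_def algebra_simps intro!: linearI)

lemma bounded_bilinear_lorentz: "bounded_bilinear lorentz"
  using bilinear_lorentz by (simp add: bilinear_conv_bounded_bilinear)

lemma pderiv_lorentz_const:
  assumes "open U" "q \<in> U" "g differentiable (at q)" "h differentiable (at q)"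
    and "\<And>x. x \<in> U \<Longrightarrow> lorentz (g x) (h x) = c"
  shows "lorentz (pderiv_at j g q) (h q) = - lorentz (g q) (pderiv_at j h q)"
proof -
  have "pderiv_at j (\<lambda>x. lorentz (g x) (h x)) q = pderiv_at j (\<lambda>x. c) q"
    by (rule pderiv_at_cong[OF assms(1,2,5)])
      (auto intro: bounded_bilinear.differentiable[OF bounded_bilinear_lorentz] assms)
  then show ?thesis
    using bounded_bilinear.pderiv_at[OF bounded_bilinear_lorentz assms(3,4)] by simp
qed


section \<open>Moving frames\<close>

lemmas bounded_linear_vec_clifford = linear_vec_clifford[unfolded linear_conv_bounded_linear]
lemmas bounded_linear_reversion = linear_reversion[unfolded linear_conv_bounded_linear]
lemmas clifford_mult_pderiv_at = bounded_bilinear.pderiv_at[OF bounded_bilinear_clifford_mult]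
lemmas clifford_mult_differentiable = bounded_bilinear.differentiable[OF bounded_bilinear_clifford_mult]

lemma bounded_linear_differentiable:
  "bounded_linear L \<Longrightarrow> g differentiable (at x) \<Longrightarrow> (\<lambda>x. L (g x)) differentiable (at x)"
  unfolding differentiable_def using bounded_linear.has_derivative by blast

locale spin_frame =
  fixes U :: "(real ^ 'm::finite) set" and \<Phi> :: "real ^ 'm \<Rightarrow> 'n::finite clifford"
  assumes open_U: "open U" and smooth_frame: "smooth_on U \<Phi>" and spin: "\<Phi> ` U \<subseteq> spin_group"
begin

abbreviation F :: "real ^ 'm \<Rightarrow> 'n mink \<Rightarrow> 'n mink" where "F q \<equiv> spin_act (\<Phi> q)"

lemma in_spin: "q \<in> U \<Longrightarrow> \<Phi> q \<in> spin_group"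
  using spin by auto

lemma frame_differentiable: "q \<in> U \<Longrightarrow> \<Phi> differentiable (at q)"
  using smooth_frame by (rule smooth_on_differentiable)

lemmas reversion_frame_differentiable =
  bounded_linear_differentiable[OF bounded_linear_reversion frame_differentiable]

lemma smooth_action: "smooth_on U (\<lambda>q. F q v)"
proof -
  obtain L :: "'n clifford \<Rightarrow> 'n mink" where L: "linear L" "L \<circ> vec_clifford = id"
    using linear_injective_left_inverse[OF linear_vec_clifford inj_vec_clifford] by blast
  have "Ck_on k U (\<lambda>q. L (reversion (\<Phi> q) * (vec_clifford v * \<Phi> q)))" for k
    using L(1) smooth_frame
    by (intro Ck_on_linear[OF _ open_U, of L] bounded_bilinear.Ck_on[OF bounded_bilinear_clifford_mult open_U]
        Ck_on_linear[OF bounded_linear_reversion open_U]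
        Ck_on_linear[OF bounded_bilinear.bounded_linear_right[OF bounded_bilinear_clifford_mult] open_U])
      (simp_all add: smooth_on_def linear_conv_bounded_linear)
  moreover have "L (reversion (\<Phi> q) * (vec_clifford v * \<Phi> q)) = F q v" if "q \<in> U" for q
    using arg_cong[OF vec_clifford_spin_act[OF in_spin[OF that]], of L v] pointfree_idE[OF L(2)]
    by (simp add: mult.assoc)
  ultimately have "Ck_on k U (\<lambda>q. F q v)" for k
    by (rule Ck_on_cong[OF open_U, rotated])
  then show ?thesis by (simp add: smooth_on_def)
qed

lemmas action_differentiable = smooth_on_differentiable[OF smooth_action]

lemma vec_pderiv_action:
  assumes "q \<in> U"
  shows "vec_clifford (pderiv_at j (\<lambda>q. F q v) q)
    = reversion (pderiv_at j \<Phi> q) * vec_clifford v * \<Phi> q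
      + reversion (\<Phi> q) * vec_clifford v * pderiv_at j \<Phi> q"
proof -
  have d: "(\<lambda>q. reversion (\<Phi> q) * (vec_clifford v * \<Phi> q)) differentiable (at q)"
    by (intro clifford_mult_differentiable differentiable_const
        reversion_frame_differentiable frame_differentiable assms)
  have "vec_clifford (pderiv_at j (\<lambda>q. F q v) q) = pderiv_at j (\<lambda>q. vec_clifford (F q v)) q"
    by (simp add: pderiv_at_linear[OF bounded_linear_vec_clifford] action_differentiable assms)
  also have "\<dots> = pderiv_at j (\<lambda>q. reversion (\<Phi> q) * (vec_clifford v * \<Phi> q)) q"
    by (rule pderiv_at_cong[OF open_U assms, symmetric, OF _ d])
      (simp add: vec_clifford_spin_act in_spin mult.assoc)
  also have "\<dots> = reversion (pderiv_at j \<Phi> q) * vec_clifford v * \<Phi> q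
      + reversion (\<Phi> q) * vec_clifford v * pderiv_at j \<Phi> q"
    using assms
    by (simp add: clifford_mult_pderiv_at clifford_mult_differentiable frame_differentiable
        reversion_frame_differentiable pderiv_at_linear[OF bounded_linear_reversion] mult.assoc)
  finally show ?thesis .
qed

lemma pderiv_action_linear:
  assumes "q \<in> U"
  shows "linear (\<lambda>v. pderiv_at j (\<lambda>q. F q v) q)"
proof -
  have "vec_clifford (pderiv_at j (\<lambda>q. F q (v + w)) q)
      = vec_clifford (pderiv_at j (\<lambda>q. F q v) q + pderiv_at j (\<lambda>q. F q w) q)"
    and "vec_clifford (pderiv_at j (\<lambda>q. F q (r *\<^sub>R v)) q)
      = vec_clifford (r *\<^sub>R pderiv_at j (\<lambda>q. F q v) q)" for v w r
    by (simp_all add: vec_pderiv_action assms linear_add[OF linear_vec_clifford]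
        linear_cmul[OF linear_vec_clifford] algebra_simps)
  then show ?thesis by (intro linearI) simp_all
qed

lemma pderiv_action_skew:
  assumes "q \<in> U"
  shows "lorentz (pderiv_at j (\<lambda>q. F q v) q) (F q w) = - lorentz (F q v) (pderiv_at j (\<lambda>q. F q w) q)"
  by (rule pderiv_lorentz_const[OF open_U assms, where c = "lorentz v w"])
    (auto intro: action_differentiable assms simp: in_spin)

lemma frame_pderiv_skew:
  assumes "q \<in> U"
  shows "\<Phi> q * reversion (pderiv_at j \<Phi> q) = - (pderiv_at j \<Phi> q * reversion (\<Phi> q))"
    and "reversion (pderiv_at j \<Phi> q) * \<Phi> q = - (reversion (\<Phi> q) * pderiv_at j \<Phi> q)"
proof -
  note rules = clifford_mult_pderiv_at clifford_mult_differentiable frame_differentiable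
    reversion_frame_differentiable pderiv_at_linear[OF bounded_linear_reversion] assms
  have "pderiv_at j (\<lambda>q. \<Phi> q * reversion (\<Phi> q)) q = pderiv_at j (\<lambda>q. 1) q"
    by (rule pderiv_at_cong[OF open_U assms]) (simp_all add: spin_group_reversion in_spin rules)
  then show "\<Phi> q * reversion (pderiv_at j \<Phi> q) = - (pderiv_at j \<Phi> q * reversion (\<Phi> q))"
    by (simp add: rules eq_neg_iff_add_eq_0 add.commute)
  have "pderiv_at j (\<lambda>q. reversion (\<Phi> q) * \<Phi> q) q = pderiv_at j (\<lambda>q. 1) q"
    by (rule pderiv_at_cong[OF open_U assms]) (simp_all add: spin_group_reversion in_spin rules)
  then show "reversion (pderiv_at j \<Phi> q) * \<Phi> q = - (reversion (\<Phi> q) * pderiv_at j \<Phi> q)"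
    by (simp add: rules eq_neg_iff_add_eq_0 add.commute)
qed

lemma frame_pderiv_even:
  assumes "q \<in> U"
  shows "pderiv_at j \<Phi> q \<in> clifford_even"
proof -
  have "coef (pderiv_at j \<Phi> q) A = 0" if "odd (card A)" for A
  proof -
    have "coef (pderiv_at j \<Phi> q) A = pderiv_at j (\<lambda>q. \<Phi> q \<bullet> blade A) q"
      by (subst pderiv_at_linear[OF bounded_linear_inner_left])
        (simp_all add: frame_differentiable assms inner_blade)
    also have "\<dots> = pderiv_at j (\<lambda>q. 0) q"
      by (rule pderiv_at_cong[OF open_U assms _ bounded_linear_differentiable[OF
              bounded_linear_inner_left frame_differentiable[OF assms]]])
        (use spin_group_even[OF in_spin] that in \<open>auto simp: inner_blade clifford_even_def\<close>)
    finally show ?thesis by simp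
  qed
  then show ?thesis by (simp add: clifford_even_def)
qed

lemma clifford_commutator:
  assumes "lorentz w e = 0"
  shows "vec_clifford v * (vec_clifford w * vec_clifford e)
      - vec_clifford w * vec_clifford e * vec_clifford v
    = vec_clifford ((2 * lorentz v e) *\<^sub>R w - (2 * lorentz v w) *\<^sub>R e)"
proof -
  let ?v = "vec_clifford v" and ?w = "vec_clifford w" and ?e = "vec_clifford e"
  have "?v * ?w + ?w * ?v = (- 2 * lorentz v w) *\<^sub>R 1" "?v * ?e + ?e * ?v = (- 2 * lorentz v e) *\<^sub>R 1"
    by (rule clifford_relation)+
  then have "(?v * ?w + ?w * ?v) * ?e - ?w * (?v * ?e + ?e * ?v)
      = (2 * lorentz v e) *\<^sub>R ?w - (2 * lorentz v w) *\<^sub>R ?e"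
    by simp
  then show ?thesis
    by (simp add: algebra_simps linear_diff[OF linear_vec_clifford] linear_cmul[OF linear_vec_clifford])
qed

theorem pderiv_action_iff:
  assumes q: "q \<in> U" and orth: "lorentz w e = 0"
  shows "pderiv_at j \<Phi> q = vec_clifford w * vec_clifford e * \<Phi> q \<longleftrightarrow>
    (\<forall>v. pderiv_at j (\<lambda>q. F q v) q = F q ((2 * lorentz v e) *\<^sub>R w - (2 * lorentz v w) *\<^sub>R e))"
proof -
  define P where "P = \<Phi> q"
  define R where "R = reversion P"
  define X where "X = pderiv_at j \<Phi> q * R"
  define B where "B = vec_clifford w * vec_clifford e"
  have inv [simp]: "P * R = 1" "R * P = 1"
    using spin_group_reversion[OF in_spin[OF q]] by (simp_all add: P_def R_def)
  have inv' [simp]: "P * (R * x) = x" "R * (P * x) = x" for x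
    by (simp_all flip: mult.assoc)
  have D: "pderiv_at j \<Phi> q = X * P" by (simp add: X_def mult.assoc)
  have revD: "reversion (pderiv_at j \<Phi> q) = - (R * X)"
  proof -
    have "reversion (pderiv_at j \<Phi> q) = (reversion (pderiv_at j \<Phi> q) * P) * R"
      by (simp add: mult.assoc)
    also have "reversion (pderiv_at j \<Phi> q) * P = - (R * pderiv_at j \<Phi> q)"
      unfolding P_def R_def by (rule frame_pderiv_skew(2)[OF q])
    finally show ?thesis by (simp add: X_def mult.assoc)
  qed
  have action: "vec_clifford (pderiv_at j (\<lambda>q. F q v) q)
      = R * (vec_clifford v * X - X * vec_clifford v) * P" for v
    unfolding vec_pderiv_action[OF q] revD D[symmetric]
    by (simp add: D algebra_simps flip: P_def R_def)
  have target: "vec_clifford (F q ((2 * lorentz v e) *\<^sub>R w - (2 * lorentz v w) *\<^sub>R e))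
      = R * (vec_clifford v * B - B * vec_clifford v) * P" for v
    unfolding vec_clifford_spin_act[OF in_spin[OF q]] clifford_commutator[OF orth, symmetric] B_def
    by (simp add: P_def R_def)
  show ?thesis unfolding B_def[symmetric] P_def[symmetric]
  proof
    assume "pderiv_at j \<Phi> q = B * P"
    then have "X = B" by (simp add: X_def mult.assoc)
    then have "vec_clifford (pderiv_at j (\<lambda>q. F q v) q)
        = vec_clifford (F q ((2 * lorentz v e) *\<^sub>R w - (2 * lorentz v w) *\<^sub>R e))" for v
      unfolding action target by simp
    then show "\<forall>v. pderiv_at j (\<lambda>q. F q v) q
        = spin_act P ((2 * lorentz v e) *\<^sub>R w - (2 * lorentz v w) *\<^sub>R e)"
      by (simp add: P_def)
  next
    assume asm: "\<forall>v. pderiv_at j (\<lambda>q. F q v) q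
        = spin_act P ((2 * lorentz v e) *\<^sub>R w - (2 * lorentz v w) *\<^sub>R e)"
    have "vec_clifford v * (X - B) = (X - B) * vec_clifford v" for v
    proof -
      have "R * (vec_clifford v * X - X * vec_clifford v) * P
          = R * (vec_clifford v * B - B * vec_clifford v) * P"
        using asm[unfolded P_def, rule_format, of v] action[of v] target[of v] by simp
      then have "P * (R * (vec_clifford v * X - X * vec_clifford v) * P) * R
          = P * (R * (vec_clifford v * B - B * vec_clifford v) * P) * R"
        by simp
      then show ?thesis by (simp add: mult.assoc) (simp add: algebra_simps)
    qed
    moreover have "X - B \<in> clifford_even"
      unfolding X_def B_def R_def P_def
      by (intro subspace_diff[OF subspace_clifford_even] clifford_even_mult vec_mult_vec_even
          frame_pderiv_even reversion_even spin_group_even in_spin q)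
    ultimately obtain c where c: "X - B = c *\<^sub>R 1"
      using even_central_scalar by blast
    have "reversion X = - X"
      using frame_pderiv_skew(1)[OF q] by (simp add: X_def reversion_mult R_def P_def)
    moreover have "reversion B = - B"
      using clifford_relation[of e w] orth
      by (simp add: B_def reversion_mult lorentz_commute[of e w] eq_neg_iff_add_eq_0)
    ultimately have "reversion (X - B) = - (X - B)"
      by (simp add: linear_diff[OF linear_reversion])
    then have "c *\<^sub>R (1 :: 'n clifford) = - (c *\<^sub>R 1)"
      by (simp add: c linear_cmul[OF linear_reversion])
    then have "X = B" using c by (simp add: eq_neg_iff_add_eq_0 flip: scaleR_add_left)
    then show "pderiv_at j \<Phi> q = B * P" by (simp add: D)
  qed
qed

end

section \<open>Ribaucour pairs\<close>

lemma lorentz_basis_right: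
  "lorentz v (e_space i) = fst (snd v) $ i"
  "lorentz v e_zero = - snd (snd v) / 2"
  "lorentz v e_infty = - fst v / 2"
  by (simp_all add: lorentz_def e_space_def e_zero_def e_infty_def inner_axis)

definition coordinate_space :: "'n::finite set \<Rightarrow> 'n mink set" where
  "coordinate_space I = {v. \<forall>i. i \<notin> I \<longrightarrow> fst (snd v) $ i = 0}"

lemma subspace_coordinate_space: "subspace (coordinate_space I)"
  by (simp add: subspace_def coordinate_space_def)

lemma basis_in_coordinate_space:
  "e_zero \<in> coordinate_space I" "e_infty \<in> coordinate_space I"
  "i \<in> I \<Longrightarrow> e_space i \<in> coordinate_space I"
  by (auto simp: coordinate_space_def e_zero_def e_infty_def e_space_def axis_def)

lemma dim_coordinate_space: "dim (coordinate_space (I :: 'n::finite set)) = card I + 2"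
proof -
  let ?d = "insert e_zero (insert e_infty (e_space ` I)) :: 'n mink set"
  have sub: "?d \<subseteq> Basis"
    by (auto simp: e_zero_def e_infty_def e_space_def Basis_prod_def axis_in_Basis_iff zero_prod_def)
  have basis: "(Basis :: 'n mink set) = insert e_zero (insert e_infty (range e_space))"
    by (auto simp: e_zero_def e_infty_def e_space_def Basis_prod_def Basis_vec_def zero_prod_def)
  have inj: "inj e_space"
    by (auto simp: inj_def e_space_def axis_eq_axis)
  have coords: "v \<bullet> e_space i = fst (snd v) $ i" for v and i :: 'n
    by (simp add: e_space_def inner_prod_def inner_axis)
  have ne: "e_space i \<noteq> e_zero" "e_space i \<noteq> e_infty" for i :: 'n
    by (simp_all add: e_space_def e_zero_def e_infty_def)
  have "coordinate_space I = {v. \<forall>b\<in>Basis. b \<notin> ?d \<longrightarrow> v \<bullet> b = 0}"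
    unfolding basis coordinate_space_def
    by (auto simp: coords ne inj_image_mem_iff[OF inj])
  then have "dim (coordinate_space I) = card ?d"
    using dim_substandard[OF sub] by simp
  also have "\<dots> = card I + 2"
    by (subst card_insert_disjoint; simp add: e_zero_def e_infty_def e_space_def image_iff
        card_image inj_on_subset[OF inj[unfolded e_space_def]])+
  finally show ?thesis .
qed

lemma coordinate_space_subset:
  assumes "subspace V" "e_zero \<in> V" "e_infty \<in> V" "\<And>i. i \<in> I \<Longrightarrow> e_space i \<in> V"
  shows "coordinate_space I \<subseteq> V"
proof
  fix v :: "'a mink" assume v: "v \<in> coordinate_space I"
  have "(fst (snd v) $ i) *\<^sub>R e_space i \<in> V" for i
    using v assms(1,4) by (cases "i \<in> I") (auto simp: coordinate_space_def subspace_scale subspace_0)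
  then show "v \<in> V"
    by (subst mink_basis_expansion)
      (intro subspace_add subspace_sum subspace_scale[OF _ assms(2)] subspace_scale[OF _ assms(3)]
        assms(1))
qed

lemma vec_clifford_split:
  assumes "inj \<iota>"
  shows "vec_clifford w = snd (snd w) *\<^sub>R vec_clifford e_infty
    + (\<Sum>i\<in>UNIV. (fst (snd w) $ \<iota> i) *\<^sub>R vec_clifford (e_space (\<iota> i)))
    + (\<Sum>i\<in>- range \<iota>. (fst (snd w) $ i) *\<^sub>R vec_clifford (e_space i))
    + fst w *\<^sub>R vec_clifford e_zero"
proof -
  let ?h = "\<lambda>i. (fst (snd w) $ i) *\<^sub>R vec_clifford (e_space i)"
  have "vec_clifford w = fst w *\<^sub>R vec_clifford e_zero + sum ?h UNIV
      + snd (snd w) *\<^sub>R vec_clifford e_infty"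
    by (subst mink_basis_expansion[of w])
      (simp only: linear_add[OF linear_vec_clifford] linear_sum[OF linear_vec_clifford]
        linear_cmul[OF linear_vec_clifford])
  also have "sum ?h UNIV = sum ?h (range \<iota>) + sum ?h (- range \<iota>)"
    by (subst sum.union_disjoint[symmetric]) auto
  also have "sum ?h (range \<iota>) = (\<Sum>i\<in>UNIV. ?h (\<iota> i))"
    using sum.reindex[OF assms, of ?h] by simp
  finally show ?thesis by (simp add: add_ac)
qed

locale ribaucour_frame = spin_frame U \<Phi>
  for U :: "(real ^ 'm::finite) set" and \<Phi> :: "real ^ 'm \<Rightarrow> 'n::finite clifford" +
  fixes \<iota> :: "'m \<Rightarrow> 'n"
  assumes inj_index: "inj \<iota>"
begin

lemma structure_equation_iff:
  "(\<exists>(l :: 'm \<Rightarrow> real ^ 'm \<Rightarrow> real) (lh :: 'm \<Rightarrow> real ^ 'm \<Rightarrow> real)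
      (\<gamma> :: 'm \<Rightarrow> 'm \<Rightarrow> real ^ 'm \<Rightarrow> real) (a :: 'n \<Rightarrow> 'm \<Rightarrow> real ^ 'm \<Rightarrow> real).
      (\<forall>j. \<forall>q\<in>U. \<gamma> j j q = 0) \<and>
      (\<forall>j. \<forall>q\<in>U. pderiv_at j \<Phi> q =
        (l j q *\<^sub>R vec_clifford e_infty
         + (1 / 2) *\<^sub>R (\<Sum>i\<in>UNIV. \<gamma> i j q *\<^sub>R vec_clifford (e_space (\<iota> i)))
         + (1 / 2) *\<^sub>R (\<Sum>i\<in>- range \<iota>. a i j q *\<^sub>R vec_clifford (e_space i))
         + lh j q *\<^sub>R vec_clifford e_zero)
        * vec_clifford (e_space (\<iota> j)) * \<Phi> q))
  \<longleftrightarrow> (\<forall>j. \<forall>q\<in>U. \<exists>w. lorentz w (e_space (\<iota> j)) = 0 \<and>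
        pderiv_at j \<Phi> q = vec_clifford w * vec_clifford (e_space (\<iota> j)) * \<Phi> q)"
    (is "?L \<longleftrightarrow> ?R")
proof
  assume ?L
  then obtain l lh :: "'m \<Rightarrow> real ^ 'm \<Rightarrow> real" and \<gamma> :: "'m \<Rightarrow> 'm \<Rightarrow> real ^ 'm \<Rightarrow> real"
    and a :: "'n \<Rightarrow> 'm \<Rightarrow> real ^ 'm \<Rightarrow> real"
    where \<gamma>: "\<And>j q. q \<in> U \<Longrightarrow> \<gamma> j j q = 0"
      and eq: "\<And>j q. q \<in> U \<Longrightarrow> pderiv_at j \<Phi> q =
        (l j q *\<^sub>R vec_clifford e_infty
         + (1 / 2) *\<^sub>R (\<Sum>i\<in>UNIV. \<gamma> i j q *\<^sub>R vec_clifford (e_space (\<iota> i)))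
         + (1 / 2) *\<^sub>R (\<Sum>i\<in>- range \<iota>. a i j q *\<^sub>R vec_clifford (e_space i))
         + lh j q *\<^sub>R vec_clifford e_zero)
        * vec_clifford (e_space (\<iota> j)) * \<Phi> q"
    by blast
  show ?R
  proof (intro allI ballI)
    fix j q assume q: "q \<in> U"
    define w :: "'n mink" where "w = (lh j q,
      \<chi> i. (if i \<in> range \<iota> then \<gamma> (inv \<iota> i) j q else a i j q) / 2, l j q)"
    have "lorentz w (e_space (\<iota> j)) = 0"
      by (simp add: lorentz_basis_right w_def inj_index \<gamma> q)
    moreover have "vec_clifford w = l j q *\<^sub>R vec_clifford e_infty
         + (1 / 2) *\<^sub>R (\<Sum>i\<in>UNIV. \<gamma> i j q *\<^sub>R vec_clifford (e_space (\<iota> i)))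
         + (1 / 2) *\<^sub>R (\<Sum>i\<in>- range \<iota>. a i j q *\<^sub>R vec_clifford (e_space i))
         + lh j q *\<^sub>R vec_clifford e_zero"
      by (subst vec_clifford_split[OF inj_index])
        (auto simp: w_def inj_index scaleR_sum_right intro!: sum.cong)
    ultimately show "\<exists>w. lorentz w (e_space (\<iota> j)) = 0 \<and>
        pderiv_at j \<Phi> q = vec_clifford w * vec_clifford (e_space (\<iota> j)) * \<Phi> q"
      using eq[OF q, of j] by (intro exI[of _ w]) simp
  qed
next
  assume ?R
  then obtain w where w: "\<And>j q. q \<in> U \<Longrightarrow> lorentz (w j q) (e_space (\<iota> j)) = 0"
    "\<And>j q. q \<in> U \<Longrightarrow>
      pderiv_at j \<Phi> q = vec_clifford (w j q) * vec_clifford (e_space (\<iota> j)) * \<Phi> q"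
    by metis
  show ?L
  proof (intro exI conjI allI ballI)
    fix j q assume q: "q \<in> U"
    show "2 * fst (snd (w j q)) $ \<iota> j = 0"
      using w(1)[OF q, of j] by (simp add: lorentz_basis_right)
    show "pderiv_at j \<Phi> q = (snd (snd (w j q)) *\<^sub>R vec_clifford e_infty
         + (1 / 2) *\<^sub>R (\<Sum>i\<in>UNIV. (2 * fst (snd (w j q)) $ \<iota> i) *\<^sub>R vec_clifford (e_space (\<iota> i)))
         + (1 / 2) *\<^sub>R (\<Sum>i\<in>- range \<iota>. (2 * fst (snd (w j q)) $ i) *\<^sub>R vec_clifford (e_space i))
         + fst (w j q) *\<^sub>R vec_clifford e_zero)
        * vec_clifford (e_space (\<iota> j)) * \<Phi> q"
      unfolding w(2)[OF q] by (subst vec_clifford_split[OF inj_index, of "w j q"])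
        (simp add: scaleR_sum_right)
  qed
qed

lemma action_linear: "q \<in> U \<Longrightarrow> linear (F q)"
  using in_spin by (rule linear_spin_act)

lemma action_lorentz: "q \<in> U \<Longrightarrow> lorentz (F q v) (F q w) = lorentz v w"
  using in_spin by (rule lorentz_spin_act)

lemma action_surj: "q \<in> U \<Longrightarrow> \<exists>v. x = F q v"
  using bij_spin_act[OF in_spin] by (meson bij_is_surj surjD)

lemma dim_action_coordinate_space:
  assumes "q \<in> U"
  shows "dim (F q ` coordinate_space I) = card I + 2"
  using dim_image_eq[OF action_linear[OF assms], of "coordinate_space I"]
    bij_is_inj[OF bij_spin_act[OF in_spin[OF assms]]]
  by (simp add: dim_coordinate_space inj_on_subset)

lemma k_sphere_action:
  assumes "q \<in> U"
  shows "k_sphere (card K) (F q ` coordinate_space (\<iota> ` K))"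
proof -
  have "F q (e_zero + e_infty) \<in> F q ` coordinate_space (\<iota> ` K)"
    by (intro imageI subspace_add[OF subspace_coordinate_space] basis_in_coordinate_space)
  moreover have "lorentz (F q (e_zero + e_infty)) (F q (e_zero + e_infty)) < 0"
    using assms by (simp add: action_lorentz lorentz_basis_right)
      (simp add: e_zero_def e_infty_def)
  moreover have "subspace (F q ` coordinate_space (\<iota> ` K))"
    by (intro linear_subspace_image action_linear assms subspace_coordinate_space)
  moreover have "card (\<iota> ` K) = card K"
    by (rule card_image) (rule inj_on_subset[OF inj_index], simp)
  ultimately show ?thesis
    using dim_action_coordinate_space[OF assms]
    by (auto simp: k_sphere_def timelike_subspace_def)
qed

lemma tangent_space_action:
  assumes "q \<in> U"
  shows "F q v \<in> tangent_space (F q ` coordinate_space I) (F q e)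
    \<longleftrightarrow> v \<in> coordinate_space I \<and> lorentz v e = 0"
  using bij_is_inj[OF bij_spin_act[OF in_spin[OF assms]]]
  by (simp add: tangent_space_def lorentz_perp_def action_lorentz assms inj_image_mem_iff)

lemma normal_space_action:
  assumes q: "q \<in> U" and e: "e = e_zero \<or> e = e_infty"
  shows "F q n \<in> normal_space (F q ` coordinate_space I) (F q e)
    \<longleftrightarrow> lorentz n e = 0 \<and> (\<forall>i\<in>I. lorentz n (e_space i) = 0)"
    (is "?L \<longleftrightarrow> ?R")
proof
  assume L: ?L
  have "lorentz n v = 0" if "v \<in> coordinate_space I" "lorentz v e = 0" for v
  proof -
    have "F q v \<in> tangent_space (F q ` coordinate_space I) (F q e)"
      using that q by (simp add: tangent_space_action)
    then have "lorentz (F q n) (F q v) = 0"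
      using L unfolding normal_space_def lorentz_perp_def by blast
    then show ?thesis using q by (simp add: action_lorentz)
  qed
  moreover have "lorentz e e = 0" "e \<in> coordinate_space I" "lorentz (e_space i) e = 0" for i
    using e by (auto simp: lorentz_basis basis_in_coordinate_space lorentz_commute[of "e_space i"])
  ultimately show ?R by (simp add: basis_in_coordinate_space)
next
  assume R: ?R
  have "lorentz n v = 0" if "v \<in> coordinate_space I" "lorentz v e = 0" for v
  proof -
    have "fst (snd n) $ i * fst (snd v) $ i = 0" for i
      using R that(1) by (cases "i \<in> I") (auto simp: coordinate_space_def lorentz_basis_right)
    then have "fst (snd n) \<bullet> fst (snd v) = 0"
      by (simp only: inner_vec_def inner_real_def sum.neutral_const)
    moreover have "fst n * snd (snd v) + snd (snd n) * fst v = 0"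
      using R that(2) e by (auto simp: lorentz_basis_right)
    ultimately show ?thesis by (simp add: lorentz_def)
  qed
  moreover have "\<exists>v. x = F q v \<and> v \<in> coordinate_space I \<and> lorentz v e = 0"
    if "x \<in> tangent_space (F q ` coordinate_space I) (F q e)" for x
    using that action_surj[OF q, of x] tangent_space_action[OF q] by blast
  ultimately show ?L
    using q by (force simp: normal_space_def lorentz_perp_def action_lorentz)
qed

end

text \<open>
  Each lift \<open>g = F e\<close>, \<open>e \<in> {e\<^sub>0, e\<^sub>\<infinity>}\<close>, has \<open>\<partial>\<^sub>j g\<close> proportional to the
  principal direction \<open>F e\<^sub>j\<close>, and the normal fields with constant coefficients in the frame
  are parallel. Degenerate points, where \<open>\<partial>\<^sub>j g = 0\<close>, need no separate treatment.
\<close>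

locale structured_frame = ribaucour_frame +
  fixes w :: "'a \<Rightarrow> real ^ 'a \<Rightarrow> 'b mink"
  assumes w_orth: "\<And>j q. q \<in> U \<Longrightarrow> lorentz (w j q) (e_space (\<iota> j)) = 0"
    and pderiv_action: "\<And>j q v. q \<in> U \<Longrightarrow> pderiv_at j (\<lambda>q. F q v) q
      = F q ((2 * lorentz v (e_space (\<iota> j))) *\<^sub>R w j q - (2 * lorentz v (w j q)) *\<^sub>R e_space (\<iota> j))"
begin

lemma pderiv_action_orth:
  assumes "q \<in> U" "lorentz v (e_space (\<iota> j)) = 0"
  shows "pderiv_at j (\<lambda>q. F q v) q = F q ((- 2 * lorentz v (w j q)) *\<^sub>R e_space (\<iota> j))"
  using assms by (simp add: pderiv_action)

lemma coordinate_curvature_lines_action: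
  assumes e: "e = e_zero \<or> e = e_infty" and M: "M \<subseteq> U"
  shows "coordinate_curvature_lines K M (\<lambda>q. F q e) (\<lambda>q. F q ` coordinate_space (\<iota> ` K))"
proof -
  let ?g = "\<lambda>q. F q e" and ?V = "\<lambda>q. F q ` coordinate_space (\<iota> ` K)"
  define l where "l j q = - 2 * lorentz e (w j q)" for j q
  have e_orth: "lorentz e (e_space i) = 0" for i
    using e by (auto simp: lorentz_basis)
  have dg: "pderiv_at j ?g q = F q (l j q *\<^sub>R e_space (\<iota> j))" if "q \<in> U" for j q
    unfolding l_def by (rule pderiv_action_orth[OF that e_orth])
  have orth: "lorentz (pderiv_at i ?g q) (pderiv_at j ?g q)
      = (if i = j then l i q * l j q else 0)" if "q \<in> U" for i j q
    using that inj_index by (auto simp: dg action_lorentz lorentz_basis dest: injD)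
  have principal: "principal_direction K ?g q N i"
    if "q \<in> M" "i \<in> K" "N \<in> normal_space (?V q) (?g q)" for q i N
  proof -
    have q: "q \<in> U" using M that by auto
    obtain n where N: "N = F q n" using action_surj[OF q] by blast
    have n: "lorentz n (e_space (\<iota> j)) = 0" if "j \<in> K" for j
      using \<open>N \<in> _\<close> that unfolding N normal_space_action[OF q e] by blast
    have "lorentz N (pderiv_at i (pderiv_at j ?g) q)
        = (if i = j then 2 * lorentz n (w i q) * l i q else 0)" if "j \<in> K" for j
    proof -
      have "lorentz (pderiv_at i (pderiv_at j ?g) q) (F q n)
          = - lorentz (pderiv_at j ?g q) (pderiv_at i (\<lambda>q. F q n) q)"
      proof (rule pderiv_lorentz_const[OF open_U q])
        show "lorentz (pderiv_at j ?g x) (F x n) = 0" if "x \<in> U" for x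
          using n[OF \<open>j \<in> K\<close>] that
          by (simp add: dg action_lorentz lorentz_commute[of "e_space _"])
      qed (auto intro: smooth_on_differentiable smooth_on_pderiv_at smooth_action q)
      also have "\<dots> = 2 * lorentz n (w i q) * l j q * lorentz (e_space (\<iota> j)) (e_space (\<iota> i))"
        by (simp add: dg pderiv_action_orth q n \<open>i \<in> K\<close> action_lorentz)
      also have "\<dots> = (if i = j then 2 * lorentz n (w i q) * l i q else 0)"
        using inj_index by (auto simp: lorentz_basis dest: injD)
      finally show ?thesis by (simp add: N lorentz_commute)
    qed
    then show ?thesis
      unfolding principal_direction_def
      by (intro exI[of _ "2 * lorentz n (w i q) / l i q"]) (auto simp: orth q)
  qed
  have "flat_normal_bundle K M ?g ?V"
    unfolding flat_normal_bundle_def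
  proof (intro ballI)
    fix q N assume "q \<in> M" and N: "N \<in> normal_space (?V q) (?g q)"
    then have q: "q \<in> U" using M by auto
    obtain n where n: "N = F q n" using action_surj[OF q] by blast
    obtain r where r: "r > 0" "ball q r \<subseteq> U" using open_U q by (auto simp: open_contains_ball)
    have "F x n \<in> normal_space (?V x) (?g x)" if "x \<in> U" for x
      using N unfolding n normal_space_action[OF q e] normal_space_action[OF that e] .
    moreover have "pderiv_at i (\<lambda>x. F x n) x \<in> tangent_space (?V x) (?g x)"
      if "x \<in> U" "i \<in> K" for x i
    proof -
      have "lorentz n (e_space (\<iota> i)) = 0"
        using N that(2) unfolding n normal_space_action[OF q e] by blast
      then show ?thesis
        using that e_orth
        by (auto simp: pderiv_action_orth tangent_space_action lorentz_commute[of "e_space _"]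
            intro!: subspace_scale[OF subspace_coordinate_space] basis_in_coordinate_space
            simp del: scaleR_minus_left scaleR_left.minus)
    qed
    moreover have "smooth_on (ball q r) (\<lambda>x. F x n)"
      using smooth_action Ck_on_subset r(2) unfolding smooth_on_def by blast
    ultimately show "\<exists>r>0. \<exists>N'. smooth_on (ball q r) N' \<and> N' q = N \<and>
        (\<forall>x\<in>M \<inter> ball q r. N' x \<in> normal_space (?V x) (?g x) \<and>
           (\<forall>i\<in>K. pderiv_at i N' x \<in> tangent_space (?V x) (?g x)))"
      using r n by (intro exI[of _ r] exI[of _ "\<lambda>x. F x n"] conjI ballI) auto
  qed
  then show ?thesis
    using orth principal M unfolding coordinate_curvature_lines_def by auto
qed

lemma envelopes_action:
  assumes e: "e = e_zero \<or> e = e_infty" and M: "M \<subseteq> U"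
  shows "envelopes K M (\<lambda>q. F q e) (\<lambda>q. F q ` coordinate_space (\<iota> ` K))"
proof -
  have "e \<in> coordinate_space (\<iota> ` K)" "lorentz e (e_space i) = 0" for i
    using e by (auto simp: lorentz_basis basis_in_coordinate_space)
  then show ?thesis
    using M by (auto simp: envelopes_def first_order_contact_def pderiv_action_orth
        intro!: imageI subspace_scale[OF subspace_coordinate_space] basis_in_coordinate_space
        simp del: scaleR_minus_left scaleR_left.minus)
qed

lemma ribaucour_pair_action:
  assumes "conformal_immersion U (\<lambda>q. F q e_zero) \<or> conformal_immersion U (\<lambda>q. F q e_infty)"
  shows "ribaucour_pair U (\<lambda>q. F q e_zero) (\<lambda>q. F q e_infty)"
proof -
  have cone: "F q e \<in> light_cone" if "q \<in> U" "e = e_zero \<or> e = e_infty" for q e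
  proof -
    have "e \<noteq> 0" "lorentz e e = 0"
      using that(2) by (auto simp: lorentz_basis) (auto simp: e_zero_def e_infty_def zero_prod_def)
    moreover have "F q e = 0 \<longleftrightarrow> e = 0"
      using linear_injective_0[OF action_linear] bij_is_inj[OF bij_spin_act[OF in_spin]] that(1)
        linear_0[OF action_linear] by blast
    ultimately show ?thesis using that(1) by (simp add: light_cone_def action_lorentz)
  qed
  have "ribaucour_congruence K (subnet_domain U K p) (\<lambda>q. F q ` coordinate_space (\<iota> ` K))
      (\<lambda>q. F q e_zero) (\<lambda>q. F q e_infty)" for K p
  proof -
    have "subnet_domain U K p \<subseteq> U" by (auto simp: subnet_domain_def)
    then show ?thesis
      by (auto simp: ribaucour_congruence_def k_sphere_action envelopes_action
          coordinate_curvature_lines_action)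
  qed
  moreover have "(\<lambda>q. F q e_zero) ` U \<subseteq> light_cone" "(\<lambda>q. F q e_infty) ` U \<subseteq> light_cone"
    using cone by blast+
  ultimately show ?thesis
    using assms smooth_action unfolding ribaucour_pair_def by blast
qed

end

lemma subspace_lorentz_perp: "subspace (lorentz_perp S)"
  by (simp add: subspace_def lorentz_perp_def)

lemma (in structured_frame) adapted_frame_action:
  "adapted_frame \<iota> U \<Phi> (\<lambda>q. F q e_zero) (\<lambda>q. F q e_infty)"
proof -
  define W where "W = (\<lambda>q. lorentz_perp ({F q e_zero, F q e_infty} \<union> range (\<lambda>i. F q (e_space (\<iota> i)))))"
  have s_in_W: "F q (e_space i) \<in> W q" if "q \<in> U" "i \<notin> range \<iota>" for q i
    using that
    by (auto simp: W_def lorentz_perp_def action_lorentz lorentz_basis lorentz_commute[of "e_space i"])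
  have "span ((\<lambda>i. F q (e_space i)) ` (- range \<iota>)) = W q" if q: "q \<in> U" for q
  proof
    show "span ((\<lambda>i. F q (e_space i)) ` (- range \<iota>)) \<subseteq> W q"
      using s_in_W q by (intro span_minimal) (auto simp: W_def subspace_lorentz_perp)
  next
    show "W q \<subseteq> span ((\<lambda>i. F q (e_space i)) ` (- range \<iota>))"
    proof
      fix x assume "x \<in> W q"
      moreover obtain v where x: "x = F q v" using action_surj[OF q] by blast
      ultimately have v: "fst v = 0" "snd (snd v) = 0" "fst (snd v) $ \<iota> i = 0" for i
        using q by (auto simp: W_def lorentz_perp_def action_lorentz lorentz_basis_right)
      have "(fst (snd v) $ i) *\<^sub>R F q (e_space i) \<in> span ((\<lambda>i. F q (e_space i)) ` (- range \<iota>))" for i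
        using v(3) by (cases "i \<in> range \<iota>") (auto intro: span_scale span_base simp: span_zero)
      moreover have "x = (\<Sum>i\<in>UNIV. (fst (snd v) $ i) *\<^sub>R F q (e_space i))"
        unfolding x using action_linear[OF q]
        by (subst mink_basis_expansion) (simp add: v linear_sum linear_cmul)
      ultimately show "x \<in> span ((\<lambda>i. F q (e_space i)) ` (- range \<iota>))"
        by (simp add: span_sum)
    qed
  qed
  then have "orthonormal_basis (- range \<iota>) (\<lambda>i. F q (e_space i)) (W q)" if "q \<in> U" for q
    using that by (simp add: orthonormal_basis_def action_lorentz lorentz_basis)
  moreover have principal: "pderiv_at j (\<lambda>q. F q v) q \<in> span {F q (e_space (\<iota> j))}"
    if "q \<in> U" "lorentz v (e_space (\<iota> j)) = 0" for j q v
    unfolding pderiv_action_orth[OF that] linear_cmul[OF action_linear[OF that(1)]]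
    by (intro span_scale span_base) simp
  moreover have "parallel_section U W (\<lambda>q. F q (e_space i))" if i: "i \<notin> range \<iota>" for i
    unfolding parallel_section_def
  proof (intro ballI conjI allI)
    fix q j assume q: "q \<in> U"
    show "F q (e_space i) \<in> W q" using q i by (rule s_in_W)
    have "F q (e_space (\<iota> j)) \<in> lorentz_perp (W q)"
      by (auto simp: W_def lorentz_perp_def lorentz_commute[of "F q (e_space (\<iota> j))"])
    then have "span {F q (e_space (\<iota> j))} \<subseteq> lorentz_perp (W q)"
      by (simp add: span_minimal subspace_lorentz_perp)
    moreover have "lorentz (e_space i) (e_space (\<iota> j)) = 0"
      using i by (auto simp: lorentz_basis)
    ultimately show "pderiv_at j (\<lambda>q. F q (e_space i)) q \<in> lorentz_perp (W q)"
      using principal[OF q] by blast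
  qed
  moreover have "lorentz (pderiv_at j (\<lambda>q. F q e_zero) q) (F q e_infty) = 0" if "q \<in> U" for q j
    using that by (simp add: pderiv_action_orth lorentz_basis action_lorentz
        lorentz_commute[of "e_space _" e_infty])
  ultimately show ?thesis
    unfolding W_def by (simp add: adapted_frame_def Let_def lorentz_basis)
qed

context ribaucour_frame
begin

text \<open>
  The contact elements of the immersed envelope determine the enveloped 2-sphere, so that \<open>F e\<^sub>a\<close>
  is normal to it; that both coordinate directions are principal for \<open>F e\<^sub>a\<close> gives the claim.
\<close>

lemma ribaucour_congruence_orth:
  assumes e: "e = e_zero \<or> e = e_infty" and imm: "conformal_immersion U (\<lambda>q. F q e)"
    and der: "\<And>k x. x \<in> U \<Longrightarrow> pderiv_at k (\<lambda>q. F q e) x \<in> span {F x (e_space (\<iota> k))}"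
    and rib: "ribaucour_congruence {i, j} (subnet_domain U {i, j} q) s (\<lambda>q. F q e_zero) (\<lambda>q. F q e_infty)"
    and q: "q \<in> U" and "i \<noteq> j" "a \<noteq> \<iota> i" "a \<noteq> \<iota> j"
  shows "lorentz (F q (e_space (\<iota> j))) (pderiv_at i (\<lambda>q. F q (e_space a)) q) = 0"
proof -
  let ?g = "\<lambda>q. F q e" and ?K = "{i, j}" and ?C = "coordinate_space (\<iota> ` {i, j})"
  have qM: "q \<in> subnet_domain U ?K q" using q by (simp add: subnet_domain_def)
  have card: "card ?K = 2" using \<open>i \<noteq> j\<close> by simp
  have ribs: "k_sphere 2 (s q)" "envelopes ?K (subnet_domain U ?K q) (\<lambda>q. F q e_zero) s"
    "envelopes ?K (subnet_domain U ?K q) (\<lambda>q. F q e_infty) s"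
    "coordinate_curvature_lines ?K (subnet_domain U ?K q) ?g s"
    using rib e qM unfolding ribaucour_congruence_def card by auto
  have V: "subspace (s q)" "dim (s q) = 4"
    using ribs(1) by (auto simp: k_sphere_def timelike_subspace_def)
  have in_V: "F q e_zero \<in> s q" "F q e_infty \<in> s q" "\<And>k. k \<in> ?K \<Longrightarrow> pderiv_at k ?g q \<in> s q"
    using ribs(2,3) qM e by (auto simp: envelopes_def first_order_contact_def)
  have nonzero: "pderiv_at k ?g q \<noteq> 0" for k
  proof
    assume "pderiv_at k ?g q = 0"
    then have "frechet_derivative ?g (at q) (axis k 1) \<in> span {F q e}"
      by (simp add: pderiv_at_def span_zero)
    then have "axis k 1 = (0 :: real ^ 'm)"
      using imm q unfolding conformal_immersion_def by blast
    then show False by (simp add: axis_eq_0_iff)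
  qed
  have multiple: "\<exists>c. c \<noteq> 0 \<and> pderiv_at k ?g q = c *\<^sub>R F q (e_space (\<iota> k))" for k
    using der[OF q, of k] nonzero[of k] by (auto simp: span_singleton)
  have s_in_V: "F q (e_space (\<iota> k)) \<in> s q" if "k \<in> ?K" for k
  proof -
    obtain c where "c \<noteq> 0" and c: "pderiv_at k ?g q = c *\<^sub>R F q (e_space (\<iota> k))"
      using multiple by blast
    then have "F q (e_space (\<iota> k)) = (1 / c) *\<^sub>R pderiv_at k ?g q" by simp
    then show ?thesis using in_V(3)[OF that] V(1) by (simp only: subspace_scale)
  qed
  have "?C \<subseteq> F q -` s q"
    by (rule coordinate_space_subset)
      (use in_V s_in_V V(1) action_linear[OF q] in \<open>auto intro: linear_subspace_vimage\<close>)
  moreover have "card (\<iota> ` ?K) = 2"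
    using inj_index \<open>i \<noteq> j\<close> by (auto simp: card_insert_if dest: injD)
  moreover have "subspace (F q ` ?C)"
    by (intro linear_subspace_image action_linear q subspace_coordinate_space)
  ultimately have V_eq: "s q = F q ` ?C"
    using V dim_action_coordinate_space[OF q, of "\<iota> ` ?K"]
    by (intro subspace_dim_equal[symmetric]) auto
  have e_orth: "lorentz (e_space a) e = 0"
    using e by (auto simp: lorentz_basis lorentz_commute[of "e_space a"])
  have "F q (e_space a) \<in> normal_space (s q) (?g q)"
    unfolding V_eq normal_space_action[OF q e]
    using e_orth \<open>a \<noteq> \<iota> i\<close> \<open>a \<noteq> \<iota> j\<close> by (auto simp: lorentz_basis)
  then have "principal_direction ?K ?g q (F q (e_space a)) i"
    and orth: "lorentz (pderiv_at i ?g q) (pderiv_at j ?g q) = 0"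
    using ribs(4) qM \<open>i \<noteq> j\<close> by (auto simp: coordinate_curvature_lines_def)
  then have "lorentz (F q (e_space a)) (pderiv_at i (pderiv_at j ?g) q) = 0"
    by (auto simp: principal_direction_def)
  moreover have "lorentz (pderiv_at i (pderiv_at j ?g) q) (F q (e_space a))
      = - lorentz (pderiv_at j ?g q) (pderiv_at i (\<lambda>q. F q (e_space a)) q)"
  proof (rule pderiv_lorentz_const[OF open_U q])
    show "lorentz (pderiv_at j ?g x) (F x (e_space a)) = 0" if "x \<in> U" for x
      using der[OF that, of j] that \<open>a \<noteq> \<iota> j\<close>
      by (auto simp: span_singleton action_lorentz lorentz_basis)
  qed (auto intro: smooth_on_differentiable smooth_on_pderiv_at smooth_action q)
  ultimately have "lorentz (pderiv_at j ?g q) (pderiv_at i (\<lambda>q. F q (e_space a)) q) = 0"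
    by (simp add: lorentz_commute)
  then show ?thesis using multiple[of j] by auto
qed

lemma structure_equation_of_ribaucour:
  assumes imm: "conformal_immersion U (\<lambda>q. F q e_zero) \<or> conformal_immersion U (\<lambda>q. F q e_infty)"
    and adapted: "adapted_frame \<iota> U \<Phi> (\<lambda>q. F q e_zero) (\<lambda>q. F q e_infty)"
    and rib: "ribaucour_pair U (\<lambda>q. F q e_zero) (\<lambda>q. F q e_infty)"
    and q: "q \<in> U"
  shows "\<exists>w. lorentz w (e_space (\<iota> j)) = 0 \<and> (\<forall>v. pderiv_at j (\<lambda>q. F q v) q
      = F q ((2 * lorentz v (e_space (\<iota> j))) *\<^sub>R w - (2 * lorentz v w) *\<^sub>R e_space (\<iota> j)))"
proof -
  let ?e = "e_space (\<iota> j)"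
  define b where "b v u = lorentz (pderiv_at j (\<lambda>q. F q v) q) (F q u)" for v u
  have skew: "b v u = - b u v" for v u
    unfolding b_def using pderiv_action_skew[OF q] by (metis lorentz_commute)
  have diag: "b v v = 0" for v using skew[of v v] by simp
  define W where "W = (\<lambda>q. lorentz_perp ({F q e_zero, F q e_infty} \<union> range (\<lambda>i. F q (e_space (\<iota> i)))))"
  have der: "pderiv_at k (\<lambda>q. F q e) x \<in> span {F x (e_space (\<iota> k))}"
    if "x \<in> U" "e = e_zero \<or> e = e_infty" for x k e
    using adapted that by (auto simp: adapted_frame_def Let_def)
  have parallel: "parallel_section U W (\<lambda>q. F q (e_space i))" if "i \<notin> range \<iota>" for i
    using adapted that unfolding adapted_frame_def Let_def W_def by blast
  have null: "b e u = 0" if "e = e_zero \<or> e = e_infty" "lorentz u ?e = 0" for e u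
    using der[OF q that(1), of j] q that(2)
    by (auto simp: b_def span_singleton action_lorentz lorentz_commute[of ?e])
  have tangential: "b (e_space i) (e_space (\<iota> k)) = 0" if "k \<noteq> j" "i \<noteq> \<iota> j" for i k
  proof (cases "i = \<iota> k")
    case False
    obtain s where s: "ribaucour_congruence {j, k} (subnet_domain U {j, k} q) s
        (\<lambda>q. F q e_zero) (\<lambda>q. F q e_infty)"
    proof -
      have "\<forall>K p. K \<noteq> {} \<and> p \<in> U \<longrightarrow> (\<exists>s. ribaucour_congruence K (subnet_domain U K p) s
          (\<lambda>q. F q e_zero) (\<lambda>q. F q e_infty))"
        using rib unfolding ribaucour_pair_def by (elim conjE)
      from this[rule_format, of "{j, k}" q] show ?thesis using q that by auto
    qed
    have "lorentz (F q (e_space (\<iota> k))) (pderiv_at j (\<lambda>q. F q (e_space i)) q) = 0"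
      using imm
    proof
      assume "conformal_immersion U (\<lambda>q. F q e_zero)"
      then show ?thesis
        using ribaucour_congruence_orth[of e_zero, OF _ _ der s q] that False by auto
    next
      assume "conformal_immersion U (\<lambda>q. F q e_infty)"
      then show ?thesis
        using ribaucour_congruence_orth[of e_infty, OF _ _ der s q] that False by auto
    qed
    then show ?thesis by (simp add: b_def lorentz_commute)
  qed (simp add: diag)
  have space: "b (e_space i) (e_space k) = 0" if ik: "i \<noteq> \<iota> j" "k \<noteq> \<iota> j" for i k
  proof -
    consider k' where "k = \<iota> k'" | i' where "i = \<iota> i'" | "i \<notin> range \<iota>" "k \<notin> range \<iota>" by blast
    then show ?thesis
    proof cases
      case 1
      then show ?thesis using tangential[of k' i] ik by auto
    next
      case 2
      then show ?thesis using tangential[of i' k] ik skew[of "e_space i" "e_space k"] by auto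
    next
      case 3
      have "F q (e_space k) \<in> W q" "pderiv_at j (\<lambda>q. F q (e_space i)) q \<in> lorentz_perp (W q)"
        using parallel 3 q unfolding parallel_section_def by blast+
      then show ?thesis by (simp add: b_def lorentz_perp_def)
    qed
  qed
  obtain w where w: "(1 / 2) *\<^sub>R pderiv_at j (\<lambda>q. F q ?e) q = F q w"
    using action_surj[OF q] by blast
  have be: "b ?e u = 2 * lorentz w u" for u
  proof -
    have "2 * lorentz (F q w) (F q u) = b ?e u"
      unfolding w[symmetric] b_def by simp
    then show ?thesis using q by (simp add: action_lorentz)
  qed
  have orth: "lorentz w ?e = 0" using be[of ?e] diag[of ?e] by simp
  have unit: "lorentz ?e ?e = 1" by (simp add: lorentz_basis)
  have basis: "b v u = 2 * lorentz v ?e * lorentz w u - 2 * lorentz v w * lorentz ?e u"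
    if vu: "v \<in> insert e_zero (insert e_infty (range e_space))"
      "u \<in> insert e_zero (insert e_infty (range e_space))" for v u
  proof (cases "v = ?e \<or> u = ?e")
    case True
    then show ?thesis
      using skew[of v u]
      by (auto simp: be orth unit lorentz_commute[of ?e w] lorentz_commute[of v w])
  next
    case False
    have o: "lorentz x ?e = 0" if "x \<in> insert e_zero (insert e_infty (range e_space))" "x \<noteq> ?e" for x
      using that by (auto simp: lorentz_basis)
    have "b v u = 0"
    proof -
      consider "v = e_zero \<or> v = e_infty" | "u = e_zero \<or> u = e_infty"
        | i k where "v = e_space i" "u = e_space k"
        using vu by blast
      then show ?thesis
      proof cases
        case 1
        then show ?thesis using null[OF 1 o[OF vu(2)]] False by simp
      next
        case 2
        then show ?thesis using null[OF 2 o[OF vu(1)]] skew[of v u] False by simp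
      next
        case 3
        then show ?thesis using space[of i k] False by auto
      qed
    qed
    then show ?thesis
      using o[of v] o[of u] vu False by (simp add: lorentz_commute[of ?e])
  qed
  have "b v u = 2 * lorentz v ?e * lorentz w u - 2 * lorentz v w * lorentz ?e u" for v u
  proof -
    note lin = pderiv_action_linear[OF q] action_linear[OF q]
    note blin = linear_add[OF lin(1)] linear_cmul[OF lin(1)] linear_0[OF lin(1)]
      linear_add[OF lin(2)] linear_cmul[OF lin(2)] linear_0[OF lin(2)]
    let ?B = "insert e_zero (insert e_infty (range e_space)) :: 'n mink set"
    let ?rhs = "\<lambda>v u. 2 * lorentz v ?e * lorentz w u - 2 * lorentz v w * lorentz ?e u"
    have sub: "subspace {v. b v u = ?rhs v u}" "subspace {u. b v u = ?rhs v u}" for v u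
      by (auto simp: subspace_def b_def blin) (simp_all add: algebra_simps)
    have generated: "x \<in> S" if "subspace S" "?B \<subseteq> S" for S x
      by (rule mink_subspace_UNIV[OF that(1)]) (use that(2) in auto)
    have "v \<in> {v. b v u = ?rhs v u}" if "u \<in> ?B" for u v
      by (rule generated[OF sub(1)]) (use basis[OF _ that] in blast)
    then have "u \<in> {u. b v u = ?rhs v u}"
      by (intro generated[OF sub(2)]) blast
    then show ?thesis by simp
  qed
  then have "lorentz (pderiv_at j (\<lambda>q. F q v) q) (F q u)
      = lorentz (F q ((2 * lorentz v ?e) *\<^sub>R w - (2 * lorentz v w) *\<^sub>R ?e)) (F q u)" for v u
    using q by (simp add: action_lorentz flip: b_def)
  then have "pderiv_at j (\<lambda>q. F q v) q = F q ((2 * lorentz v ?e) *\<^sub>R w - (2 * lorentz v w) *\<^sub>R ?e)" for v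
    by (intro lorentz_nondegenerate) (metis action_surj q)
  then show ?thesis using orth by blast
qed

theorem adapted_ribaucour_iff:
  assumes imm: "conformal_immersion U (\<lambda>q. F q e_zero) \<or> conformal_immersion U (\<lambda>q. F q e_infty)"
  shows "adapted_frame \<iota> U \<Phi> (\<lambda>q. F q e_zero) (\<lambda>q. F q e_infty)
      \<and> ribaucour_pair U (\<lambda>q. F q e_zero) (\<lambda>q. F q e_infty)
    \<longleftrightarrow> (\<forall>j. \<forall>q\<in>U. \<exists>w. lorentz w (e_space (\<iota> j)) = 0 \<and>
        pderiv_at j \<Phi> q = vec_clifford w * vec_clifford (e_space (\<iota> j)) * \<Phi> q)"
    (is "?L \<longleftrightarrow> ?R")
proof
  assume ?L
  then show ?R
    using structure_equation_of_ribaucour[OF imm] pderiv_action_iff by blast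
next
  assume ?R
  then obtain w where w: "\<And>j q. q \<in> U \<Longrightarrow> lorentz (w j q) (e_space (\<iota> j)) = 0"
    "\<And>j q. q \<in> U \<Longrightarrow>
      pderiv_at j \<Phi> q = vec_clifford (w j q) * vec_clifford (e_space (\<iota> j)) * \<Phi> q"
    by metis
  interpret structured_frame U \<Phi> \<iota> w
    by unfold_locales (use w pderiv_action_iff in blast)+
  show ?L using adapted_frame_action ribaucour_pair_action[OF imm] by blast
qed

end

theorem mainTheorem1:
  fixes \<iota> :: "'m::finite \<Rightarrow> 'n::finite"
    and U :: "(real ^ 'm) set"
    and \<Phi> :: "real ^ 'm \<Rightarrow> 'n clifford"
    and f fh :: "real ^ 'm \<Rightarrow> 'n mink"
  assumes "inj \<iota>"
    and "open U" and "connected U" and "U \<noteq> {}"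
    and "smooth_on U \<Phi>" and "\<Phi> ` U \<subseteq> spin_group"
    and "f = (\<lambda>q. spin_act (\<Phi> q) e_zero)"
    and "fh = (\<lambda>q. spin_act (\<Phi> q) e_infty)"
    and "conformal_immersion U f \<or> conformal_immersion U fh"
  shows "adapted_frame \<iota> U \<Phi> f fh \<and> ribaucour_pair U f fh \<longleftrightarrow>
    (\<exists>(l :: 'm \<Rightarrow> real ^ 'm \<Rightarrow> real) (lh :: 'm \<Rightarrow> real ^ 'm \<Rightarrow> real)
      (\<gamma> :: 'm \<Rightarrow> 'm \<Rightarrow> real ^ 'm \<Rightarrow> real) (a :: 'n \<Rightarrow> 'm \<Rightarrow> real ^ 'm \<Rightarrow> real).
      (\<forall>j. \<forall>q\<in>U. \<gamma> j j q = 0) \<and>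
      (\<forall>j. \<forall>q\<in>U. pderiv_at j \<Phi> q =
        (l j q *\<^sub>R vec_clifford e_infty
         + (1 / 2) *\<^sub>R (\<Sum>i\<in>UNIV. \<gamma> i j q *\<^sub>R vec_clifford (e_space (\<iota> i)))
         + (1 / 2) *\<^sub>R (\<Sum>i\<in>- range \<iota>. a i j q *\<^sub>R vec_clifford (e_space i))
         + lh j q *\<^sub>R vec_clifford e_zero)
        * vec_clifford (e_space (\<iota> j)) * \<Phi> q))"
proof -
  interpret ribaucour_frame U \<Phi> \<iota>
    using assms by unfold_locales
  show ?thesis
    unfolding structure_equation_iff
    using adapted_ribaucour_iff assms(9) unfolding assms(7,8) .
qed

end
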